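(* Let $T>0$ be given, let $M\ge1$ be an integer, $0<\nu_M<\dots<\nu_1<\nu_0<1$, and let $\mathbf{D}_t$ be either the type I operator $\mathbf{D}_tv=\sum_{i=0}^Mr_i(t)\mathbf{D}_t^{\nu_i}v$ or the type II operator $\mathbf{D}_tv=\sum_{i=0}^M\mathbf{D}_t^{\nu_i}(r_iv)$. Consider the Cauchy problem $$\mathbf{D}_tv+\mathcal{K}*v+v=f_0(t)+f(t,v),\quad t>0,\qquad v(0)=v_0. \tag{P}$$ Assume that $r_i\in\mathcal{C}([0,T])$, $i=0,\dots,M$, $r_0(t)\ne0$ for all $t\in[0,T]$, and $$\mathcal{K}\in L^1(0,T),\qquad f_0\in\mathcal{C}([0,T]),\qquad f\in\mathcal{C}([0,T]\times\mathbb{R}).$$ Assume that there exist a positive $T^*\le T$ and $\alpha^*\in(0,1)$ such that $v$ is a unique solution of (P) for $t\le T^*$, $v$ satisfies (P) in the classical sense for all $t\in[0,T^*]$, $v\in\mathcal{C}_{\nu_0}^{\alpha^*}([0,T^*])$, and $\mathbf{D}_t^{\nu_i}v\in\mathcal{C}^{\alpha^*}([0,T^*])$, $i=1,\dots,M$. In the case of the type II operator assume additionally that each $r_i$, $i=0,\dots,M$, has one of the following regularities: (i) either $r_i\in\mathcal{C}^1([0,T^*])$; (ii) or, if $\alpha^*+\nu_i<1$, then $r_i\in\mathcal{C}^{\mu_i}([0,T^*])\cap\mathcal{C}_{\nu_i}^{\mu^*}([0,T^*])$ for some $\mu_i\in(\alpha^*+\nu_i,1)$ and $\mu^*\in(0,1)$;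 (iii) or, if $1\le\alpha^*+\nu_i<2$, then $r_i\in\mathcal{C}^{\mu^*}_{\mu_i}([0,T^*])$ and $\mathbf{D}_t^{\nu_i}r_i\in\mathcal{C}^{\mu_1^*}([0,T^*])$ with some $\mu_i\in(\nu_i,1)$ and $\mu^*,\mu_1^*\in(0,1)$. If $$f_0(0)+f(0,v_0)-v_0\neq0\ \text{ (type I)},\qquad f_0(0)+f(0,v_0)-v_0-v_0\sum_{i=1}^M\mathbf{D}_t^{\nu_i}r_i(0)\ne0\ \text{ (type II)},$$ then $$\nu_0=\lim_{t\to 0}\frac{t[v(t)-v(0)]}{\int_0^t[v(\tau)-v(0)]\,d\tau}-1\ \text{ (type I)},\qquad \nu_0=\lim_{t\to 0}\frac{t[r_0(t)v(t)-r_0(0)v(0)]}{\int_0^t[r_0(\tau)v(\tau)-r_0(0)v(0)]\,d\tau}-1\ \text{ (type II)}.$$ Moreover, for all $t\in[0,T^*]$ the solution admits the representation, for type I, $$v(t)=v(0)+\mathfrak{C}_0t^{\nu_0}+\frac{1}{\Gamma(\nu_0)}\int_0^t(t-\tau)^{\nu_0-1}\big[\mathbf{D}_\tau^{\nu_0}v(\tau)-\mathbf{D}_\tau^{\nu_0}v(0)\big]d\tau,\qquad \mathfrak{C}_0=\frac{\mathbf{D}_tv(0)}{r_0(0)\Gamma(1+\nu_0)},$$ and, for type II, $$r_0(t)v(t)=r_0(0)v(0)+\mathfrak{C}_1t^{\nu_0}+\frac{1}{\Gamma(\nu_0)}\int_0^t(t-\tau)^{\nu_0-1}\big[\mathbf{D}_\tau^{\nu_0}(r_0v)(\tau)-\mathbf{D}_\tau^{\nu_0}(r_0v)(0)\big]d\tau,$$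 $$\mathfrak{C}_1=\frac{\mathbf{D}_tv|_{t=0}-v(0)\sum_{i=1}^{M}\mathbf{D}_t^{\nu_i}r_i(0)}{\Gamma(1+\nu_0)}.$$
   Context: All functions are real-valued and limits $t\to0$ are one-sided ($t>0$). For $\nu\in(0,1)$ the regularized (left) Caputo derivative is $$\mathbf{D}_t^{\nu}v(t)=\frac{1}{\Gamma(1-\nu)}\frac{d}{dt}\int_0^t\frac{v(s)-v(0)}{(t-s)^{\nu}}\,ds,$$ where $\Gamma$ is the Euler Gamma-function. When $\mathbf{D}_t^\nu v$ is continuous on a closed interval $[0,T]$, its value at $t=0$ is the continuous extension. The time convolution is $(\eta_1*\eta_2)(t)=\int_0^t\eta_1(t-\tau)\eta_2(\tau)d\tau$. $\mathcal{C}([0,T])$ is the space of continuous functions, $\mathcal{C}^{\alpha}([0,T])$, $\alpha\in(0,1)$, the usual Hölder space with seminorm $\langle\cdot\rangle^{(\alpha)}_{t,[0,T]}$, $\mathcal{C}^1$ the continuously differentiable functions. For $\nu,\alpha\in(0,1)$, $\mathcal{C}^{\alpha}_{\nu}([0,T])$ is the space of continuous $v$ with $\mathbf{D}_t^\nu v$ continuous on $[0,T]$ and finite norm $\|v\|_{\mathcal{C}([0,T])}+\|\mathbf{D}_t^{\nu}v\|_{\mathcal{C}([0,T])}+\langle\mathbf{D}_t^{\nu}v\rangle^{(\alpha)}_{t,[0,T]}$. *)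

theory Defs
  imports "HOL-Analysis.Analysis"
begin

(* Functions on [0,T] are total functions real => real of which only the values on [0,T] are used;
   derivatives are therefore taken within {0..T}: two-sided in the interior, one-sided at T. *)

definition caputo_integral :: "real \<Rightarrow> (real \<Rightarrow> real) \<Rightarrow> real \<Rightarrow> real" where
  "caputo_integral \<nu> v t = integral {0..t} (\<lambda>s. (v s - v 0) / (t - s) powr \<nu>)"

(* The regularized left Caputo derivative of order \<nu> on [0,T]; its value at 0 is the
   limit from the right. *)
definition caputo :: "real \<Rightarrow> real \<Rightarrow> (real \<Rightarrow> real) \<Rightarrow> real \<Rightarrow> real" where
  "caputo T \<nu> v t =
     (let D = (\<lambda>t. 1 / Gamma (1 - \<nu>) *
                 vector_derivative (caputo_integral \<nu> v) (at t within {0..T}))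
      in if t = 0 then Lim (at_right 0) D else D t)"

(* caputo T \<nu> v t is a genuine (not a default) value for every t in [0,T]. *)
definition caputo_differentiable :: "real \<Rightarrow> real \<Rightarrow> (real \<Rightarrow> real) \<Rightarrow> bool" where
  "caputo_differentiable T \<nu> v \<longleftrightarrow>
     (\<forall>t\<in>{0<..T}. caputo_integral \<nu> v differentiable (at t within {0..T})) \<and>
     (\<exists>L. (caputo T \<nu> v \<longlongrightarrow> L) (at_right 0))"

(* C^\<alpha>([0,T]). A bound L is an upper bound for the Hoelder seminorm. *)
definition holder_space :: "real \<Rightarrow> real \<Rightarrow> (real \<Rightarrow> real) set" where
  "holder_space \<alpha> T =
     {v. continuous_on {0..T} v \<and>
         (\<exists>L. \<forall>s\<in>{0..T}. \<forall>t\<in>{0..T}. \<bar>v t - v s\<bar> \<le> L * \<bar>t - s\<bar> powr \<alpha>)}"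

(* C^\<alpha>_\<nu>([0,T]). The two sup norms are finite by compactness of [0,T]. *)
definition caputo_holder_space :: "real \<Rightarrow> real \<Rightarrow> real \<Rightarrow> (real \<Rightarrow> real) set" where
  "caputo_holder_space \<nu> \<alpha> T =
     {v. continuous_on {0..T} v \<and> caputo_differentiable T \<nu> v \<and>
         continuous_on {0..T} (caputo T \<nu> v) \<and> caputo T \<nu> v \<in> holder_space \<alpha> T}"

(* C^1([0,T]). The library's C1_differentiable_on would ask for two-sided derivatives at 0 and T. *)
definition C1_space :: "real \<Rightarrow> (real \<Rightarrow> real) set" where
  "C1_space T =
     {v. \<exists>v'. continuous_on {0..T} v' \<and>
              (\<forall>t\<in>{0..T}. (v has_real_derivative v' t) (at t within {0..T}))}"

definition time_convolution :: "(real \<Rightarrow> real) \<Rightarrow> (real \<Rightarrow> real) \<Rightarrow> real \<Rightarrow> real" where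
  "time_convolution \<eta>1 \<eta>2 t = integral {0..t} (\<lambda>\<tau>. \<eta>1 (t - \<tau>) * \<eta>2 \<tau>)"

datatype operator_type = Type_I | Type_II

fun multi_caputo ::
  "operator_type \<Rightarrow> nat \<Rightarrow> (nat \<Rightarrow> real) \<Rightarrow> (nat \<Rightarrow> real \<Rightarrow> real) \<Rightarrow> real \<Rightarrow> (real \<Rightarrow> real) \<Rightarrow> real \<Rightarrow> real"
where
  "multi_caputo Type_I M \<nu> r T v t = (\<Sum>i\<le>M. r i t * caputo T (\<nu> i) v t)"
| "multi_caputo Type_II M \<nu> r T v t = (\<Sum>i\<le>M. caputo T (\<nu> i) (\<lambda>s. r i s * v s) t)"

fun multi_caputo_defined ::
  "operator_type \<Rightarrow> nat \<Rightarrow> (nat \<Rightarrow> real) \<Rightarrow> (nat \<Rightarrow> real \<Rightarrow> real) \<Rightarrow> real \<Rightarrow> (real \<Rightarrow> real) \<Rightarrow> bool"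
where
  "multi_caputo_defined Type_I M \<nu> r T v \<longleftrightarrow> (\<forall>i\<le>M. caputo_differentiable T (\<nu> i) v)"
| "multi_caputo_defined Type_II M \<nu> r T v \<longleftrightarrow>
     (\<forall>i\<le>M. caputo_differentiable T (\<nu> i) (\<lambda>s. r i s * v s))"

(* Classical solution on [0,T] of the Cauchy problem
   D_t v + K * v + v = f0(t) + f(t,v), v(0) = v0. *)
definition classical_solution ::
  "operator_type \<Rightarrow> nat \<Rightarrow> (nat \<Rightarrow> real) \<Rightarrow> (nat \<Rightarrow> real \<Rightarrow> real) \<Rightarrow> (real \<Rightarrow> real) \<Rightarrow>
   (real \<Rightarrow> real) \<Rightarrow> (real \<Rightarrow> real \<Rightarrow> real) \<Rightarrow> real \<Rightarrow> real \<Rightarrow> (real \<Rightarrow> real) \<Rightarrow> bool"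
where
  "classical_solution ty M \<nu> r K f0 f v0 T v \<longleftrightarrow>
     v 0 = v0 \<and> multi_caputo_defined ty M \<nu> r T v \<and>
     (\<forall>t\<in>{0..T}. multi_caputo ty M \<nu> r T v t + time_convolution K v t + v t
                   = f0 t + f t (v t))"

definition solution_class :: "nat \<Rightarrow> (nat \<Rightarrow> real) \<Rightarrow> real \<Rightarrow> real \<Rightarrow> (real \<Rightarrow> real) set" where
  "solution_class M \<nu> \<alpha> T =
     {v. v \<in> caputo_holder_space (\<nu> 0) \<alpha> T \<and>
         (\<forall>i\<in>{1..M}. caputo_differentiable T (\<nu> i) v \<and> caputo T (\<nu> i) v \<in> holder_space \<alpha> T)}"

(* The alternatives for a coefficient q that is differentiated to order \<nu> in the
   type II operator; \<alpha> is the Hoelder exponent of the solution. *)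
definition coefficient_regularity :: "real \<Rightarrow> real \<Rightarrow> real \<Rightarrow> (real \<Rightarrow> real) \<Rightarrow> bool" where
  "coefficient_regularity \<nu> \<alpha> T q \<longleftrightarrow>
     q \<in> C1_space T \<or>
     (\<alpha> + \<nu> < 1 \<and>
       (\<exists>\<mu>\<in>{\<alpha> + \<nu><..<1}. \<exists>\<mu>'\<in>{0<..<1}.
          q \<in> holder_space \<mu> T \<inter> caputo_holder_space \<nu> \<mu>' T)) \<or>
     (1 \<le> \<alpha> + \<nu> \<and> \<alpha> + \<nu> < 2 \<and>
       (\<exists>\<mu>\<in>{\<nu><..<1}. \<exists>\<mu>'\<in>{0<..<1}. \<exists>\<mu>1\<in>{0<..<1}.
          q \<in> caputo_holder_space \<mu> \<mu>' T \<and>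
          caputo_differentiable T \<nu> q \<and> caputo T \<nu> q \<in> holder_space \<mu>1 T))"

end

theory Submission
  imports Defs
begin

text \<open>Integrating the Caputo derivative \<open>D\<close> of \<open>u\<close> and applying the semigroup property of the
  Riemann--Liouville integrals inverts it: \<open>u - u(0)\<close> is the integral of order \<open>\<nu>\<close> of \<open>D\<close>. Splitting off
  \<open>D(0)\<close> gives the representation and \<open>u(t) - u(0) \<sim> D(0) t^\<nu> / \<Gamma>(1 + \<nu>)\<close>, from which the limit formula
  follows. All of this needs only that \<open>D\<close> is bounded and has a limit at \<open>0\<close>.

  For type II it is therefore not necessary to show that the Caputo derivative of \<open>r\<^sub>0 v\<close> is continuous;
  it is bounded because its Caputo integral is Lipschitz, as \<open>r\<^sub>0\<close> is Hoelder continuous with an exponent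
  larger than \<open>\<nu>\<^sub>0\<close>. The lower order terms at \<open>t = 0\<close> are read off from the quotient of the Caputo integral by \<open>t\<close>:
  since \<open>v(t) - v(0) = O(t^(\<nu>\<^sub>0))\<close> with \<open>\<nu>\<^sub>0 > \<nu>\<^sub>i\<close>, only \<open>v(0)\<close> times the derivative of \<open>r\<^sub>i\<close> survives.\<close>

subsection \<open>Riemann--Liouville integrals\<close>

lemma kernel_has_integral:
  fixes a s t :: real
  assumes "0 < a" "s \<le> t"
  shows "((\<lambda>x. (t - x) powr (a - 1)) has_integral (t - s) powr a / a) {s..t}"
proof -
  have "((\<lambda>x. x powr (a - 1)) has_integral (t - s) powr a / a) {0..t - s}"
    using has_integral_powr_from_0[of "a - 1" "t - s"] assms by simp
  then have "((\<lambda>x. (- x) powr (a - 1)) has_integral (t - s) powr a / a) {- (t - s)..-0}"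
    by (subst has_integral_reflect_real)
  from has_integral_shift_real_ivl[OF this, of "- t"] show ?thesis
    by simp
qed

text \<open>The singularity \<open>t'\<close> may lie to the right of the interval: increments of a
  fractional integral are later split at an earlier time, and the part up to that time still carries
  the kernel of the later one.\<close>

lemma kernel_absolutely_integrable:
  fixes a s t t' :: real
  assumes "0 < a" "t \<le> t'"
  shows "(\<lambda>x. (t' - x) powr (a - 1)) absolutely_integrable_on {s..t}"
proof (cases "s \<le> t'")
  case True
  have "(\<lambda>x. (t' - x) powr (a - 1)) absolutely_integrable_on {s..t'}"
    by (rule nonnegative_absolutely_integrable_1)
      (use kernel_has_integral[OF assms(1) True] in \<open>auto simp: has_integral_integrable\<close>)
  then show ?thesis
    by (rule absolutely_integrable_on_subinterval) (use assms in auto)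
\<comment> \<open>Here \<open>t \<le> t' < s\<close>, so the interval is empty.\<close>
qed (use assms in \<open>auto simp: absolutely_integrable_on_def\<close>)

text \<open>Euler's Beta integral on the unit interval, transported by the affine substitution
  sending \<open>x\<close> to \<open>m * (x - s)\<close>. In the degenerate case
  \<open>s = t\<close> both sides vanish, because \<open>0 powr c = 0\<close> for every
  \<open>c\<close>.\<close>

lemma beta_kernel_has_integral:
  fixes a b s t :: real
  assumes "0 < a" "0 < b" "s \<le> t"
  shows "((\<lambda>x. (t - x) powr (a - 1) * (x - s) powr (b - 1)) has_integral
           Beta a b * (t - s) powr (a + b - 1)) {s..t}"
proof (cases "s = t")
  case False
  define m where "m = 1 / (t - s)"
  have m: "m > 0" using False assms by (simp add: m_def)
  have *: "((\<lambda>x. x powr (b - 1) * (1 - x) powr (a - 1)) has_integral Beta b a) (cbox 0 1)"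
    using has_integral_Beta_real[OF assms(2,1)] by simp
  have "((\<lambda>x. (m * (x - s)) powr (b - 1) * (1 - m * (x - s)) powr (a - 1)) has_integral
          (t - s) * Beta b a) {s..t}"
  proof -
    have 1: "(0 - - s * m) /\<^sub>R m = s" "(1 - - s * m) /\<^sub>R m = t"
      using False assms by (simp_all add: m_def field_simps)
    have 2: "m *\<^sub>R x + - s * m = m * (x - s)" for x
      by (simp add: algebra_simps)
    have 3: "Beta b a /\<^sub>R m ^ DIM(real) = (t - s) * Beta b a"
      by (simp add: m_def)
    show ?thesis
      using has_integral_affinity'[OF * m, of "- s * m"] unfolding 1 2 3 by simp
  qed
  \<comment> \<open>The prefactor undoes the scaling: one kernel absorbs
    \<open>(t - s) powr (a - 1)\<close>, the other \<open>(t - s) powr (b - 1)\<close>.\<close>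
  then have "((\<lambda>x. (t - s) powr (a + b - 2) *
        ((m * (x - s)) powr (b - 1) * (1 - m * (x - s)) powr (a - 1))) has_integral
          (t - s) powr (a + b - 2) * ((t - s) * Beta b a)) {s..t}"
    by (rule has_integral_mult_right)
  moreover have "(t - s) powr (a + b - 2) * ((t - s) * Beta b a)
      = Beta a b * (t - s) powr (a + b - 1)"
  proof -
    have "(t - s) powr (a + b - 1) = (t - s) powr (a + b - 2) * (t - s)"
      using False assms powr_add[of "t - s" "a + b - 2" 1] by (simp add: algebra_simps)
    then show ?thesis by (simp add: Beta_commute)
  qed
  moreover have "(t - s) powr (a + b - 2) *
        ((m * (x - s)) powr (b - 1) * (1 - m * (x - s)) powr (a - 1))
      = (t - x) powr (a - 1) * (x - s) powr (b - 1)" if "x \<in> {s..t}" for x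
  proof -
    have eq: "1 - m * (x - s) = m * (t - x)"
      using False assms by (simp add: m_def field_simps)
    have pw: "(t - s) powr (a + b - 2) = (t - s) powr (a - 1) * (t - s) powr (b - 1)"
      by (simp flip: powr_add)
    have "(t - s) powr c * (m * y) powr c = y powr c" if "y \<ge> 0" for c y
      using that m False assms by (simp add: powr_mult[symmetric] m_def)
    from this[of "x - s" "b - 1"] this[of "t - x" "a - 1"] that
    show ?thesis
      unfolding eq pw by (simp add: mult_ac)
  qed
  ultimately show ?thesis
    by (metis (no_types, lifting) has_integral_eq)
qed (use has_integral_refl in auto)

lemma kernel_times_bounded_absolutely_integrable:
  fixes g :: "real \<Rightarrow> real"
  assumes "0 < a" "t \<le> t'" "g absolutely_integrable_on {s..t}" "\<And>x. x \<in> {s..t} \<Longrightarrow> \<bar>g x\<bar> \<le> B"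
  shows "(\<lambda>x. (t' - x) powr (a - 1) * g x) absolutely_integrable_on {s..t}"
proof -
  have "(\<lambda>x. g x * (t' - x) powr (a - 1)) absolutely_integrable_on {s..t}"
  proof (rule absolutely_integrable_bounded_measurable_product_real)
    show "g \<in> borel_measurable (lebesgue_on {s..t})"
      using assms(3) by (simp add: absolutely_integrable_measurable)
    show "bounded (g ` {s..t})"
      using assms(4) by (auto simp: bounded_iff intro!: exI[of _ B])
  qed (use kernel_absolutely_integrable assms in auto)
  then show ?thesis by (simp add: mult.commute)
qed

lemma kernel_integral_bound:
  fixes g :: "real \<Rightarrow> real"
  assumes "0 < a" "s \<le> t" "g absolutely_integrable_on {s..t}" "\<And>x. x \<in> {s..t} \<Longrightarrow> \<bar>g x\<bar> \<le> B"
  shows "\<bar>integral {s..t} (\<lambda>x. (t - x) powr (a - 1) * g x)\<bar> \<le> B * (t - s) powr a / a"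
proof -
  have "norm (integral {s..t} (\<lambda>x. (t - x) powr (a - 1) * g x))
      \<le> integral {s..t} (\<lambda>x. B * (t - x) powr (a - 1))"
  proof (rule integral_norm_bound_integral)
    show "(\<lambda>x. (t - x) powr (a - 1) * g x) integrable_on {s..t}"
      using kernel_times_bounded_absolutely_integrable[OF assms(1) _ assms(3,4), of t]
      by (simp add: absolutely_integrable_on_def)
    show "(\<lambda>x. B * (t - x) powr (a - 1)) integrable_on {s..t}"
      using kernel_has_integral[OF assms(1,2)] by (auto intro!: integrable_on_mult_right
          simp: has_integral_integrable)
    show "norm ((t - x) powr (a - 1) * g x) \<le> B * (t - x) powr (a - 1)" if "x \<in> {s..t}" for x
      using assms(4)[OF that] by (simp add: abs_mult mult.commute mult_right_mono)
  qed
  also have "\<dots> = B * ((t - s) powr a / a)"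
    using has_integral_mult_right[OF kernel_has_integral[OF assms(1,2)]] by (rule integral_unique)
  finally show ?thesis by simp
qed

section \<open>Semigroup property of the fractional integrals\<close>

text \<open>Passes from integrals over an interval to Lebesgue integrals over \<open>lborel\<close>,
  to which Fubini's theorem will be applied. Absolute integrability refers to the completed measure,
  which has more measurable functions; hence the explicit Borel measurability.\<close>

lemma absolutely_integrable_imp_lborel:
  fixes f :: "real \<Rightarrow> real"
  assumes [measurable]: "f \<in> borel_measurable borel" and "f absolutely_integrable_on {s..t}"
  shows "integrable lborel (\<lambda>x. indicator {s..t} x * f x)"
    and "(\<integral>x. indicator {s..t} x * f x \<partial>lborel) = integral {s..t} f"
proof -
  show *: "integrable lborel (\<lambda>x. indicator {s..t} x * f x)"
    using assms by (subst integrable_completion[symmetric]) (auto simp: set_integrable_def)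
  then have "set_integrable lborel {s..t} f"
    by (simp add: set_integrable_def)
  from set_borel_integral_eq_integral(2)[OF this]
  show "(\<integral>x. indicator {s..t} x * f x \<partial>lborel) = integral {s..t} f"
    by (simp add: set_lebesgue_integral_def)
qed

text \<open>Fubini on the triangle \<open>0 \<le> x \<le> s \<le> t\<close>: for fixed
  \<open>x\<close> the integral over \<open>s\<close> is a Beta integral and produces the kernel of
  order \<open>a + b\<close>. The bound on \<open>g\<close> supplies an integrable majorant.\<close>

lemma kernel_semigroup_borel:
  fixes g :: "real \<Rightarrow> real"
  assumes [measurable]: "g \<in> borel_measurable borel" and g: "\<And>x. \<bar>g x\<bar> \<le> B"
    and a: "0 < a" and b: "0 < b" and t: "0 \<le> t"
  shows "integral {0..t} (\<lambda>s. (t - s) powr (a - 1) * integral {0..s} (\<lambda>x. (s - x) powr (b - 1) * g x))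
       = Beta a b * integral {0..t} (\<lambda>x. (t - x) powr (a + b - 1) * g x)"
proof -
  \<comment> \<open>\<open>F\<close> is the integrand cut off to the triangle. \<open>F1\<close> is
    its nonnegative kernel factor without \<open>g\<close>, and \<open>B * F1\<close> will dominate
    \<open>F\<close>.\<close>
  define F where "F = (\<lambda>s x. indicator {0..t} s * (indicator {0..s} x *
      ((t - s) powr (a - 1) * ((s - x) powr (b - 1) * g x))))"
  define F1 where "F1 = (\<lambda>s x::real. indicator {0..t} s * (indicator {0..s} x *
      ((t - s) powr (a - 1) * ((s - x) powr (b - 1)))))"
  have ind: "(\<lambda>p :: real \<times> real. indicator {0..fst p} (snd p) :: real)
      \<in> borel_measurable (lborel \<Otimes>\<^sub>M lborel)"
  proof -
    have "(\<lambda>p :: real \<times> real. indicator {0..fst p} (snd p) :: real)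
        = (\<lambda>p. if 0 \<le> snd p \<and> snd p \<le> fst p then 1 else 0)"
      by (auto simp: fun_eq_iff indicator_def)
    then show ?thesis by (simp only:) measurable
  qed
  have F1_meas: "case_prod F1 \<in> borel_measurable (lborel \<Otimes>\<^sub>M lborel)"
    unfolding F1_def case_prod_beta' using ind by (intro borel_measurable_times) auto
  have F_meas: "case_prod F \<in> borel_measurable (lborel \<Otimes>\<^sub>M lborel)"
    unfolding F_def case_prod_beta' using ind by (intro borel_measurable_times) auto
  have gai: "g absolutely_integrable_on {s..u}" for s u
  proof -
    have "integrable lborel (\<lambda>x. indicator {s..u} x * g x)"
      by (rule Bochner_Integration.integrable_bound[where f="\<lambda>x. B * indicator {s..u} x"])
        (use order_trans[OF g abs_ge_self] in \<open>auto simp: abs_mult integrable_indicator_iff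
            emeasure_lborel_Icc_eq split: split_indicator\<close>)
    then show ?thesis
      by (auto simp: set_integrable_def integrable_completion)
  qed
  have in1: "integrable lborel (F1 s) \<and> (\<integral>x. F1 s x \<partial>lborel)
        = indicator {0..t} s * ((t - s) powr (a - 1) * (s powr b / b))" for s
  proof (cases "s \<in> {0..t}")
    case True
    have k: "(\<lambda>x. (t - s) powr (a - 1) * (s - x) powr (b - 1)) absolutely_integrable_on {0..s}"
      using kernel_absolutely_integrable[OF b order_refl, of 0 s]
      by (intro set_integrable_mult_right) auto
    have "integral {0..s} (\<lambda>x. (t - s) powr (a - 1) * (s - x) powr (b - 1))
        = (t - s) powr (a - 1) * (s powr b / b)"
      using has_integral_mult_right[OF kernel_has_integral[OF b, of 0 s]] True
      by (intro integral_unique) simp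
    then show ?thesis
      using absolutely_integrable_imp_lborel[OF _ k] True by (simp add: F1_def)
  qed (simp add: F1_def)
  \<comment> \<open>By Tonelli it suffices to integrate twice: the inner integral of
    \<open>F1\<close> is the kernel of order \<open>a\<close> times \<open>s powr b / b\<close>,
    which is bounded on \<open>{0..t}\<close>.\<close>
  have F1_pair: "integrable (lborel \<Otimes>\<^sub>M lborel) (case_prod F1)"
  proof (rule lborel_pair.Fubini_integrable[OF F1_meas])
    have "(\<lambda>s. (t - s) powr (a - 1) * (s powr b / b)) absolutely_integrable_on {0..t}"
    proof (rule kernel_times_bounded_absolutely_integrable[OF a order_refl])
      show "(\<lambda>s. s powr b / b) absolutely_integrable_on {0..t}"
        using b by (intro absolutely_integrable_continuous_real continuous_on_divide
            continuous_on_powr' continuous_on_id continuous_on_const) auto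
      show "\<bar>s powr b / b\<bar> \<le> t powr b / b" if "s \<in> {0..t}" for s
        using that b by (auto intro!: divide_right_mono powr_mono2)
    qed
    from absolutely_integrable_imp_lborel(1)[OF _ this]
    have "integrable lborel (\<lambda>s. indicator {0..t} s * ((t - s) powr (a - 1) * (s powr b / b)))"
      by simp
    moreover have "norm (F1 s x) = F1 s x" for s x
      by (simp add: F1_def abs_mult)
    ultimately show "integrable lborel (\<lambda>x. \<integral>y. norm (case (x, y) of (x, y) \<Rightarrow> F1 x y) \<partial>lborel)"
      using in1 by simp
    show "AE x in lborel. integrable lborel (\<lambda>y. case (x, y) of (x, y) \<Rightarrow> F1 x y)"
      using in1 by simp
  qed
  have F_pair: "integrable (lborel \<Otimes>\<^sub>M lborel) (case_prod F)"
  proof (rule Bochner_Integration.integrable_bound[OF _ F_meas])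
    show "integrable (lborel \<Otimes>\<^sub>M lborel) (\<lambda>p. B * case_prod F1 p)"
      using F1_pair by simp
    show "AE p in lborel \<Otimes>\<^sub>M lborel. norm (case_prod F p) \<le> norm (B * case_prod F1 p)"
    proof (rule AE_I2)
      fix p :: "real \<times> real"
      have "norm (case_prod F p) = \<bar>g (snd p)\<bar> * case_prod F1 p"
        by (simp add: F_def F1_def case_prod_beta' abs_mult mult_ac)
      also have "\<dots> \<le> B * case_prod F1 p"
        using g by (intro mult_right_mono) (auto simp: F1_def case_prod_beta')
      finally show "norm (case_prod F p) \<le> norm (B * case_prod F1 p)" by simp
    qed
  qed
  have left: "(\<integral>x. F s x \<partial>lborel) = indicator {0..t} s *
      ((t - s) powr (a - 1) * integral {0..s} (\<lambda>x. (s - x) powr (b - 1) * g x))" for s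
    using absolutely_integrable_imp_lborel(2)[OF _
        kernel_times_bounded_absolutely_integrable[OF b order_refl gai[of 0 s] g]]
    by (simp add: F_def mult.left_commute[of "indicator {0..s} _"])
  have right: "(\<integral>s. F s x \<partial>lborel) = indicator {0..t} x *
      (Beta a b * (t - x) powr (a + b - 1) * g x)" for x
  proof (cases "x \<in> {0..t}")
    case True
    have k: "((\<lambda>s. (t - s) powr (a - 1) * (s - x) powr (b - 1)) has_integral
           Beta a b * (t - x) powr (a + b - 1)) {x..t}"
      using beta_kernel_has_integral[OF a b, of x t] True by simp
    have k': "(\<lambda>s. (t - s) powr (a - 1) * (s - x) powr (b - 1)) absolutely_integrable_on {x..t}"
      by (rule nonnegative_absolutely_integrable_1) (use k in \<open>auto simp: has_integral_integrable\<close>)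
    \<comment> \<open>For this fixed \<open>x\<close> the two cut-offs together leave
      \<open>s\<close> in \<open>{x..t}\<close>.\<close>
    have "F s x = indicator {x..t} s * ((t - s) powr (a - 1) * (s - x) powr (b - 1)) * g x" for s
      using True by (auto simp: F_def indicator_def)
    then show ?thesis
      using absolutely_integrable_imp_lborel(2)[OF _ k'] integral_unique[OF k] True by simp
  next
    case False
    then have "F s x = 0" for s by (auto simp: F_def indicator_def)
    then show ?thesis using False by simp
  qed
  have "set_integrable lborel {0..t} (\<lambda>s. (t - s) powr (a - 1) *
      integral {0..s} (\<lambda>x. (s - x) powr (b - 1) * g x))"
    using lborel_pair.integrable_fst[OF F_pair] by (simp add: left set_integrable_def)
  from set_borel_integral_eq_integral(2)[OF this]
  have L: "integral {0..t} (\<lambda>s. (t - s) powr (a - 1) *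
      integral {0..s} (\<lambda>x. (s - x) powr (b - 1) * g x)) = (\<integral>s. \<integral>x. F s x \<partial>lborel \<partial>lborel)"
    by (simp add: left set_lebesgue_integral_def)
  have "set_integrable lborel {0..t} (\<lambda>x. Beta a b * (t - x) powr (a + b - 1) * g x)"
    using lborel_pair.integrable_snd[OF F_pair] by (simp add: right set_integrable_def)
  from set_borel_integral_eq_integral(2)[OF this]
  have R: "integral {0..t} (\<lambda>x. Beta a b * (t - x) powr (a + b - 1) * g x)
      = (\<integral>x. \<integral>s. F s x \<partial>lborel \<partial>lborel)"
    by (simp add: right set_lebesgue_integral_def)
  show ?thesis
    using L R lborel_pair.Fubini_integral[OF F_pair] by (simp add: mult.assoc)
qed

text \<open>The endpoint is excluded because \<open>0 powr x = 0\<close>, so that inequalities between singular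
  kernels fail at their singularity.\<close>

lemma abs_integral_le_except_endpoint:
  fixes f h :: "real \<Rightarrow> real"
  assumes "f integrable_on {s..t}" "(h has_integral I) {s..t}" "\<And>x. x \<in> {s..<t} \<Longrightarrow> \<bar>f x\<bar> \<le> h x"
  shows "\<bar>integral {s..t} f\<bar> \<le> I"
proof -
  have f: "((\<lambda>x. if x = t then 0 else f x) has_integral integral {s..t} f) {s..t}"
    by (rule has_integral_spike_finite[OF _ _ integrable_integral[OF assms(1)], where S="{t}"]) auto
  have h: "((\<lambda>x. if x = t then 0 else h x) has_integral I) {s..t}"
    by (rule has_integral_spike_finite[OF _ _ assms(2), where S="{t}"]) auto
  have "norm (integral {s..t} (\<lambda>x. if x = t then 0 else f x))
      \<le> integral {s..t} (\<lambda>x. if x = t then 0 else h x)"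
    using f h assms(3) by (intro integral_norm_bound_integral) (auto simp: has_integral_integrable)
  then show ?thesis
    using integral_unique[OF f] integral_unique[OF h] by simp
qed

lemma kernel_has_integral_between:
  fixes a s t u :: real
  assumes "0 < a" "s \<le> u" "u \<le> t"
  shows "((\<lambda>x. (t - x) powr (a - 1)) has_integral ((t - s) powr a - (t - u) powr a) / a) {s..u}"
proof -
  have i: "(\<lambda>x. (t - x) powr (a - 1)) integrable_on {s..u}"
    using kernel_absolutely_integrable[OF assms(1,3)] by (simp add: absolutely_integrable_on_def)
  have "integral {s..u} (\<lambda>x. (t - x) powr (a - 1)) + integral {u..t} (\<lambda>x. (t - x) powr (a - 1))
      = integral {s..t} (\<lambda>x. (t - x) powr (a - 1))"
    using assms kernel_has_integral[of a s t]
    by (intro Henstock_Kurzweil_Integration.integral_combine) (auto simp: has_integral_integrable)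
  then have "integral {s..u} (\<lambda>x. (t - x) powr (a - 1)) = ((t - s) powr a - (t - u) powr a) / a"
    using assms kernel_has_integral[of a s t] kernel_has_integral[of a u t]
    by (simp add: integral_unique diff_divide_distrib)
  then show ?thesis using i by (simp add: has_integral_iff)
qed

definition riemann_liouville :: "real \<Rightarrow> (real \<Rightarrow> real) \<Rightarrow> real \<Rightarrow> real" where
  "riemann_liouville a g t = integral {0..t} (\<lambda>s. (t - s) powr (a - 1) * g s) / Gamma a"

lemma riemann_liouville_cong:
  "(\<And>s. s \<in> {0..t} \<Longrightarrow> g s = h s) \<Longrightarrow> riemann_liouville a g t = riemann_liouville a h t"
  unfolding riemann_liouville_def by (auto intro!: arg_cong2[where f="(/)"] integral_cong)

lemma riemann_liouville_1: "riemann_liouville 1 g t = integral {0..t} g"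
proof -
  \<comment> \<open>The integrands can differ at \<open>s = t\<close> alone, where
    \<open>0 powr 0 = 0\<close>.\<close>
  have "integral {0..t} g = integral {0..t} (\<lambda>s. (t - s) powr (1 - 1) * g s)"
    by (rule integral_spike[where S="{t}"]) auto
  then show ?thesis by (simp add: riemann_liouville_def)
qed

text \<open>Reduces to Borel functions bounded on the whole line: \<open>g\<close> is replaced by a
  Borel function \<open>h\<close> that agrees with it almost everywhere on \<open>{0..T}\<close>.
  This leaves the inner fractional integrals unchanged at every point, so they can be nested. The
  Gamma factors turn the Beta function into the normalisation of order \<open>a + b\<close>.\<close>

lemma riemann_liouville_semigroup:
  assumes gi: "g absolutely_integrable_on {0..T}" and gb: "\<And>x. x \<in> {0..T} \<Longrightarrow> \<bar>g x\<bar> \<le> B"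
    and a: "0 < a" and b: "0 < b" and t: "t \<in> {0..T}"
  shows "riemann_liouville a (riemann_liouville b g) t = riemann_liouville (a + b) g t"
proof -
  have B: "0 \<le> B" using gb[OF t] by simp
  have "(\<lambda>x. indicator {0..T} x * g x) \<in> borel_measurable (completion lborel)"
    using gi by (auto simp: set_integrable_def)
  from completion_ex_borel_measurable_real[OF this] obtain g' where
    g': "g' \<in> borel_measurable lborel" "AE x in lborel. indicator {0..T} x * g x = g' x"
    by blast
  \<comment> \<open>Truncation makes the bound \<open>B\<close> hold everywhere; on
    \<open>{0..T}\<close> it changes nothing where \<open>g'\<close> equals \<open>g\<close>, since
    \<open>g\<close> is already bounded by \<open>B\<close> there.\<close>
  define h where "h = (\<lambda>x. max (- B) (min B (g' x)))"
  have hm: "h \<in> borel_measurable borel"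
    unfolding h_def using g'(1) by simp
  have hb: "\<bar>h x\<bar> \<le> B" for x
    using B by (auto simp: h_def abs_le_iff)
  obtain N where "{x \<in> space lborel. \<not> indicator {0..T} x * g x = g' x} \<subseteq> N"
    "emeasure lborel N = 0" "N \<in> sets lborel"
    using AE_E[OF g'(2)] by blast
  then have N: "N \<in> null_sets lborel" "{x. indicator {0..T} x * g x \<noteq> g' x} \<subseteq> N"
    by auto
  have neg: "negligible N"
    using N(1) by (simp add: negligible_iff_null_sets null_sets_completionI)
  have hg: "h x = g x" if "x \<in> {0..T} - N" for x
  proof -
    have "g' x = g x"
      using that N(2) by (force simp: indicator_def)
    then show ?thesis
      using that gb[of x] by (auto simp: h_def abs_le_iff)
  qed
  have eq: "integral {0..s} (\<lambda>x. (s - x) powr c * g x) = integral {0..s} (\<lambda>x. (s - x) powr c * h x)"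
    if "s \<in> {0..t}" for s c
    by (rule integral_spike[OF neg]) (use hg that t in auto)
  have "integral {0..t} (\<lambda>s. (t - s) powr (a - 1) * integral {0..s} (\<lambda>x. (s - x) powr (b - 1) * g x))
      = integral {0..t} (\<lambda>s. (t - s) powr (a - 1) * integral {0..s} (\<lambda>x. (s - x) powr (b - 1) * h x))"
    by (intro integral_cong) (simp only: eq)
  also have "\<dots> = Beta a b * integral {0..t} (\<lambda>x. (t - x) powr (a + b - 1) * h x)"
    using kernel_semigroup_borel[OF hm hb a b] t by simp
  also have "integral {0..t} (\<lambda>x. (t - x) powr (a + b - 1) * h x)
      = integral {0..t} (\<lambda>x. (t - x) powr (a + b - 1) * g x)"
    using eq[of t] t by simp
  finally show ?thesis
    using Gamma_real_pos[OF a] Gamma_real_pos[OF b] by (simp add: riemann_liouville_def Beta_def)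
qed

section \<open>Hoelder continuity of fractional integrals\<close>

text \<open>For \<open>s \<le> t\<close> the increment splits at \<open>s\<close>. On
  \<open>{0..s}\<close> the difference of the kernels has constant sign because
  \<open>a - 1 \<le> 0\<close>, and its integral can be computed; on \<open>{s..t}\<close> only the
  later kernel occurs. Each part is at most \<open>B * (t - s) powr a / a\<close>, which explains
  the factor 2.\<close>

lemma riemann_liouville_holder:
  assumes gi: "g absolutely_integrable_on {0..T}" and gb: "\<And>x. x \<in> {0..T} \<Longrightarrow> \<bar>g x\<bar> \<le> B"
    and a: "0 < a" "a \<le> 1" and s: "s \<in> {0..T}" and t: "t \<in> {0..T}"
  shows "\<bar>riemann_liouville a g t - riemann_liouville a g s\<bar> \<le> 2 * B / (a * Gamma a) * \<bar>t - s\<bar> powr a"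
  using s t
proof (induction s t rule: linorder_wlog)
  case (sym s t)
  then show ?case by (simp add: abs_minus_commute)
next
  case (le s t)
  have B: "0 \<le> B" using gb[OF t] by simp
  have gst: "g absolutely_integrable_on {u..w}" if "0 \<le> u" "w \<le> T" for u w
    using absolutely_integrable_on_subinterval[OF gi] that by auto
  note kg = kernel_times_bounded_absolutely_integrable[OF a(1) _ gst gb]
  define I where "I = (\<lambda>t. integral {0..t} (\<lambda>x. (t - x) powr (a - 1) * g x))"
  have I1: "I t = integral {0..s} (\<lambda>x. (t - x) powr (a - 1) * g x)
      + integral {s..t} (\<lambda>x. (t - x) powr (a - 1) * g x)"
    unfolding I_def using le kg[of t t 0]
    by (intro Henstock_Kurzweil_Integration.integral_combine[symmetric]) (auto simp: absolutely_integrable_on_def)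
  have i1: "(\<lambda>x. (t - x) powr (a - 1) * g x) integrable_on {0..s}"
    "(\<lambda>x. (s - x) powr (a - 1) * g x) integrable_on {0..s}"
    using le kg[of s t 0] kg[of s s 0] by (auto simp: absolutely_integrable_on_def)
  have "\<bar>integral {0..s} (\<lambda>x. (t - x) powr (a - 1) * g x - (s - x) powr (a - 1) * g x)\<bar>
      \<le> B * ((s - 0) powr a / a - ((t - 0) powr a - (t - s) powr a) / a)"
  proof (rule abs_integral_le_except_endpoint)
    show "(\<lambda>x. (t - x) powr (a - 1) * g x - (s - x) powr (a - 1) * g x) integrable_on {0..s}"
      using i1 by (rule integrable_diff)
    show "((\<lambda>x. B * ((s - x) powr (a - 1) - (t - x) powr (a - 1))) has_integral
        B * ((s - 0) powr a / a - ((t - 0) powr a - (t - s) powr a) / a)) {0..s}"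
      using le a by (intro has_integral_mult_right has_integral_diff kernel_has_integral
          kernel_has_integral_between) auto
    show "\<bar>(t - x) powr (a - 1) * g x - (s - x) powr (a - 1) * g x\<bar>
        \<le> B * ((s - x) powr (a - 1) - (t - x) powr (a - 1))" if "x \<in> {0..<s}" for x
    proof -
      have "(t - x) powr (a - 1) \<le> (s - x) powr (a - 1)"
        using that le a by (intro powr_mono2') auto
      then have "\<bar>((t - x) powr (a - 1) - (s - x) powr (a - 1)) * g x\<bar>
          \<le> ((s - x) powr (a - 1) - (t - x) powr (a - 1)) * B"
        using gb[of x] that le by (auto simp: abs_mult intro!: mult_mono)
      then show ?thesis by (simp add: algebra_simps)
    qed
  qed
  also have "\<dots> \<le> B * ((t - s) powr a / a)"
  proof (rule mult_left_mono[OF _ B])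
    \<comment> \<open>The kernel difference integrates to
      \<open>(s powr a - t powr a + (t - s) powr a) / a\<close>; monotonicity of the power disposes
      of the first two terms.\<close>
    have "s powr a \<le> t powr a"
      using le a by (intro powr_mono2) auto
    then show "(s - 0) powr a / a - ((t - 0) powr a - (t - s) powr a) / a \<le> (t - s) powr a / a"
      using a by (simp add: divide_simps)
  qed
  finally have "\<bar>integral {0..s} (\<lambda>x. (t - x) powr (a - 1) * g x)
      - integral {0..s} (\<lambda>x. (s - x) powr (a - 1) * g x)\<bar> \<le> B * ((t - s) powr a / a)"
    using i1 by (simp add: integral_diff)
  moreover have "\<bar>integral {s..t} (\<lambda>x. (t - x) powr (a - 1) * g x)\<bar> \<le> B * (t - s) powr a / a"
    using le a gb by (intro kernel_integral_bound gst) auto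
  ultimately have "\<bar>I t - I s\<bar> \<le> 2 * B / a * (t - s) powr a"
    unfolding I1 by (simp add: I_def)
  then have "\<bar>I t - I s\<bar> / Gamma a \<le> (2 * B / a * (t - s) powr a) / Gamma a"
    using Gamma_real_pos[OF a(1)] by (intro divide_right_mono) auto
  moreover have "\<bar>I t - I s\<bar> / Gamma a = \<bar>riemann_liouville a g t - riemann_liouville a g s\<bar>"
    using Gamma_real_pos[OF a(1)]
    by (simp add: riemann_liouville_def I_def flip: diff_divide_distrib)
  ultimately show ?case using le by simp
qed

lemma holder_imp_continuous_on:
  fixes f :: "real \<Rightarrow> real"
  assumes "0 < a" and "\<And>s t. s \<in> S \<Longrightarrow> t \<in> S \<Longrightarrow> \<bar>f t - f s\<bar> \<le> L * \<bar>t - s\<bar> powr a"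
  shows "continuous_on S f"
  unfolding continuous_on_def
proof
  fix s assume s: "s \<in> S"
  have "((\<lambda>t. L * \<bar>t - s\<bar> powr a) \<longlongrightarrow> L * \<bar>s - s\<bar> powr a) (at s within S)"
    by (intro tendsto_intros tendsto_powr') (use assms in auto)
  then have "((\<lambda>t. L * \<bar>t - s\<bar> powr a) \<longlongrightarrow> 0) (at s within S)"
    using assms by simp
  then have "((\<lambda>t. f t - f s) \<longlongrightarrow> 0) (at s within S)"
    by (rule Lim_null_comparison[rotated]) (use assms s in \<open>auto simp: eventually_at_filter\<close>)
  then show "(f \<longlongrightarrow> f s) (at s within S)"
    by (simp add: LIM_zero_iff)
qed

lemma continuous_riemann_liouville:
  assumes "g absolutely_integrable_on {0..T}" and "\<And>x. x \<in> {0..T} \<Longrightarrow> \<bar>g x\<bar> \<le> B"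
    and "0 < a" "a \<le> 1"
  shows "continuous_on {0..T} (riemann_liouville a g)"
  using holder_imp_continuous_on[OF assms(3) riemann_liouville_holder[OF assms]] by blast

lemma continuous_on_Icc_bounded:
  fixes g :: "real \<Rightarrow> real"
  assumes "continuous_on {s..t} g"
  obtains B where "0 \<le> B" "\<And>x. x \<in> {s..t} \<Longrightarrow> \<bar>g x\<bar> \<le> B"
proof -
  have "bounded (g ` {s..t})"
    using compact_continuous_image[OF assms compact_Icc] by (rule compact_imp_bounded)
  then obtain B where "B > 0" "\<And>x. x \<in> {s..t} \<Longrightarrow> \<bar>g x\<bar> \<le> B"
    by (auto simp: bounded_pos)
  then show ?thesis using that[of B] by simp
qed

subsection \<open>The Caputo derivative\<close>

lemma Gamma_one_minus_nonzero: "\<nu> < 1 \<Longrightarrow> Gamma (1 - \<nu> :: real) \<noteq> 0"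
  using Gamma_real_pos[of "1 - \<nu>"] by force

lemma caputo_integral_0 [simp]: "caputo_integral \<nu> u 0 = 0"
  by (simp add: caputo_integral_def)

lemma caputo_integral_eq_integral:
  "caputo_integral \<nu> u t = integral {0..t} (\<lambda>s. (t - s) powr (- \<nu>) * (u s - u 0))"
  by (simp add: caputo_integral_def powr_minus_divide)

lemma caputo_integral_eq:
  assumes "\<nu> < 1"
  shows "caputo_integral \<nu> u t = Gamma (1 - \<nu>) * riemann_liouville (1 - \<nu>) (\<lambda>s. u s - u 0) t"
  using Gamma_one_minus_nonzero[OF assms]
  by (simp add: caputo_integral_eq_integral riemann_liouville_def)

lemma continuous_on_caputo_integral:
  assumes "0 < \<nu>" "\<nu> < 1" "continuous_on {0..T} u"
  shows "continuous_on {0..T} (caputo_integral \<nu> u)"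
proof -
  have c: "continuous_on {0..T} (\<lambda>s. u s - u 0)"
    using assms by (intro continuous_intros)
  obtain B where "\<And>x. x \<in> {0..T} \<Longrightarrow> \<bar>u x - u 0\<bar> \<le> B"
    using continuous_on_Icc_bounded[OF c] by blast
  from continuous_riemann_liouville[OF absolutely_integrable_continuous_real[OF c] this, of "1 - \<nu>"]
  show ?thesis
    using assms by (simp add: caputo_integral_eq[OF assms(2), THEN ext] continuous_intros)
qed

lemma caputo_has_derivative:
  assumes "\<nu> < 1" "caputo_differentiable T \<nu> u" "t \<in> {0<..T}"
  shows "(caputo_integral \<nu> u has_real_derivative Gamma (1 - \<nu>) * caputo T \<nu> u t) (at t within {0..T})"
proof -
  have "caputo_integral \<nu> u differentiable (at t within {0..T})"
    using assms by (simp add: caputo_differentiable_def)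
  then show ?thesis
    using assms Gamma_one_minus_nonzero[OF assms(1)]
    by (simp add: vector_derivative_works has_real_derivative_iff_has_vector_derivative caputo_def)
qed

text \<open>The value at 0 is by definition a \<open>Lim\<close>, which is meaningful once the limit
  exists. A right limit ignores the point 0 itself, so the limit required of \<open>caputo\<close>
  is also that of the expression inside this \<open>Lim\<close>.\<close>

lemma caputo_tendsto_at_0:
  assumes "caputo_differentiable T \<nu> u"
  shows "(caputo T \<nu> u \<longlongrightarrow> caputo T \<nu> u 0) (at_right 0)"
proof -
  define D where "D = (\<lambda>t. 1 / Gamma (1 - \<nu>) *
                 vector_derivative (caputo_integral \<nu> u) (at t within {0..T}))"
  obtain L where L: "(caputo T \<nu> u \<longlongrightarrow> L) (at_right 0)"
    using assms by (auto simp: caputo_differentiable_def)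
  have ev: "eventually (\<lambda>t. caputo T \<nu> u t = D t) (at_right 0)"
    by (auto simp: eventually_at_filter caputo_def D_def)
  have "(D \<longlongrightarrow> L) (at_right 0)"
    using L tendsto_cong[OF ev] by simp
  then have "Lim (at_right 0) D = L"
    by (intro tendsto_Lim) auto
  then show ?thesis
    using L by (simp add: caputo_def[of T \<nu> u 0] D_def)
qed

lemma eventually_at_right_0_Ioo: "0 < T \<Longrightarrow> \<forall>\<^sub>F t in at_right 0. t \<in> {0<..<T :: real}"
  by (auto simp: eventually_at_right_field intro: exI[of _ T])

text \<open>A criterion with a continuous candidate \<open>d\<close>. For positive \<open>t\<close>
  it is the normalised derivative by uniqueness of derivatives within the interval; at 0 its
  continuity identifies the limit that defines the Caputo value.\<close>

lemma caputoI:
  assumes "0 < T" "\<nu> < 1" "continuous_on {0..T} d"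
    and der: "\<And>t. t \<in> {0<..T} \<Longrightarrow>
      (caputo_integral \<nu> u has_real_derivative Gamma (1 - \<nu>) * d t) (at t within {0..T})"
  shows "caputo_differentiable T \<nu> u" "\<And>t. t \<in> {0..T} \<Longrightarrow> caputo T \<nu> u t = d t"
proof -
  have eq: "caputo T \<nu> u t = d t" if "t \<in> {0<..T}" for t
  proof -
    have "vector_derivative (caputo_integral \<nu> u) (at t within cbox 0 T) = Gamma (1 - \<nu>) * d t"
      using der[OF that] that assms
      by (intro vector_derivative_within_cbox) (auto simp: has_real_derivative_iff_has_vector_derivative)
    then show ?thesis
      using that assms Gamma_one_minus_nonzero[OF assms(2)] by (simp add: caputo_def)
  qed
  have "(d \<longlongrightarrow> d 0) (at 0 within {0..T})"
    using assms by (auto simp: continuous_on_def)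
  then have d: "(d \<longlongrightarrow> d 0) (at_right 0)"
    using assms by (simp add: at_within_Icc_at_right)
  have "eventually (\<lambda>t. caputo T \<nu> u t = d t) (at_right 0)"
    using eventually_at_right_0_Ioo[OF assms(1)] by eventually_elim (auto intro: eq)
  then have lim: "(caputo T \<nu> u \<longlongrightarrow> d 0) (at_right 0)"
    using d tendsto_cong by blast
  then show cd: "caputo_differentiable T \<nu> u"
    unfolding caputo_differentiable_def
    using differentiableI_vector[OF der[unfolded has_real_derivative_iff_has_vector_derivative]]
    by blast
  show "caputo T \<nu> u t = d t" if "t \<in> {0..T}" for t
  proof (cases "t = 0")
    case True
    then show ?thesis
      using tendsto_unique[OF _ caputo_tendsto_at_0[OF cd] lim] by simp
  qed (use eq that in auto)
qed

text \<open>By l'Hopital, as the Caputo integral vanishes at 0 and its derivative is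
  \<open>Gamma (1 - \<nu>)\<close> times the Caputo derivative. Values at 0 can thus be found from
  the size of an integral, without differentiating a product.\<close>

lemma caputo_integral_div_tendsto:
  assumes "0 < T" "0 < \<nu>" "\<nu> < 1" "continuous_on {0..T} u" "caputo_differentiable T \<nu> u"
  shows "((\<lambda>t. caputo_integral \<nu> u t / t) \<longlongrightarrow> Gamma (1 - \<nu>) * caputo T \<nu> u 0) (at_right 0)"
proof (rule lhopital_right[where f' = "\<lambda>t. Gamma (1 - \<nu>) * caputo T \<nu> u t" and g' = "\<lambda>_. 1"])
  have "(caputo_integral \<nu> u \<longlongrightarrow> caputo_integral \<nu> u 0) (at 0 within {0..T})"
    using continuous_on_caputo_integral[OF assms(2-4)] assms(1)
    unfolding continuous_on_def by (auto dest!: bspec[where x=0])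
  then show "(caputo_integral \<nu> u \<longlongrightarrow> 0) (at_right 0)"
    using assms by (simp add: at_within_Icc_at_right)
  show "eventually (\<lambda>t. (caputo_integral \<nu> u has_real_derivative
      Gamma (1 - \<nu>) * caputo T \<nu> u t) (at t)) (at_right 0)"
    using eventually_at_right_0_Ioo[OF assms(1)]
  proof eventually_elim
    case (elim t)
    then show ?case
      using caputo_has_derivative[OF assms(3,5), of t] by (simp add: at_within_Icc_at)
  qed
  show "((\<lambda>t. Gamma (1 - \<nu>) * caputo T \<nu> u t / 1) \<longlongrightarrow> Gamma (1 - \<nu>) * caputo T \<nu> u 0) (at_right 0)"
    using caputo_tendsto_at_0[OF assms(5)] by (auto intro!: tendsto_intros)
qed (auto simp: eventually_at_filter intro!: tendsto_eq_intros)

section \<open>Inversion of the Caputo derivative\<close>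

text \<open>Write I^a for the Riemann-Liouville integral of order \<open>a\<close>. Integrating the
  derivative of the Caputo integral gives I^1 D = I^(1 - \<nu>) W. Applying the integral of order
  \<nu> and the semigroup property shows that W and the integral of order \<nu> of D have the same
  primitive; both are continuous, so they coincide.\<close>

lemma caputo_inversion:
  assumes T: "0 < T" and \<nu>: "0 < \<nu>" "\<nu> < 1" and u: "continuous_on {0..T} u"
    and cd: "caputo_differentiable T \<nu> u" and bd: "\<And>t. t \<in> {0..T} \<Longrightarrow> \<bar>caputo T \<nu> u t\<bar> \<le> B"
  shows "caputo T \<nu> u absolutely_integrable_on {0..T}"
    and "\<And>t. t \<in> {0..T} \<Longrightarrow> u t = u 0 + riemann_liouville \<nu> (caputo T \<nu> u) t"
proof -
  define D where "D = caputo T \<nu> u"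
  define W where "W = (\<lambda>s. u s - u 0)"
  have G: "Gamma (1 - \<nu>) > 0" using \<nu> by simp
  have W: "continuous_on {0..T} W"
    unfolding W_def using u by (intro continuous_intros)
  obtain BW where BW: "\<And>x. x \<in> {0..T} \<Longrightarrow> \<bar>W x\<bar> \<le> BW"
    using continuous_on_Icc_bounded[OF W] by blast
  have Wi: "W absolutely_integrable_on {0..T}"
    using W by (rule absolutely_integrable_continuous_real)
  have J: "((\<lambda>s. Gamma (1 - \<nu>) * D s) has_integral caputo_integral \<nu> u t - caputo_integral \<nu> u 0) {0..t}"
    if "t \<in> {0..T}" for t
  \<comment> \<open>The derivative is known only for positive arguments; at the end point 0
    continuity of the Caputo integral takes its place.\<close>
  proof (rule fundamental_theorem_of_calculus_interior)
    show "continuous_on {0..t} (caputo_integral \<nu> u)"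
      by (rule continuous_on_subset[OF continuous_on_caputo_integral[OF \<nu> u]]) (use that in auto)
    show "(caputo_integral \<nu> u has_vector_derivative Gamma (1 - \<nu>) * D x) (at x)"
      if "x \<in> {0<..<t}" for x
      using caputo_has_derivative[OF \<nu>(2) cd, of x] that \<open>t \<in> {0..T}\<close>
      by (simp add: at_within_Icc_at D_def has_real_derivative_iff_has_vector_derivative)
  qed (use that in auto)
  have D: "(D has_integral riemann_liouville (1 - \<nu>) W t) {0..t}" if "t \<in> {0..T}" for t
    using has_integral_mult_right[OF J[OF that], of "1 / Gamma (1 - \<nu>)"] G
    by (simp add: caputo_integral_eq[OF \<nu>(2)] W_def)
  have Db: "\<bar>D t\<bar> \<le> B" if "t \<in> {0..T}" for t
    using bd that by (simp add: D_def)
  \<comment> \<open>Integrability is part of the fundamental theorem just applied; domination by the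
    constant \<open>B\<close> makes it absolute.\<close>
  show Di: "caputo T \<nu> u absolutely_integrable_on {0..T}"
    by (rule absolutely_integrable_integrable_bound[where g="\<lambda>_. B"])
      (use D[of T] Db T in \<open>auto simp: D_def has_integral_integrable\<close>)
  have Di: "D absolutely_integrable_on {0..T}"
    using Di by (simp add: D_def)
  have int_eq: "integral {0..t} W = integral {0..t} (riemann_liouville \<nu> D)" if t: "t \<in> {0..T}" for t
  proof -
    have "integral {0..t} W = riemann_liouville (\<nu> + (1 - \<nu>)) W t"
      by (simp add: riemann_liouville_1)
    also have "\<dots> = riemann_liouville \<nu> (riemann_liouville (1 - \<nu>) W) t"
      using riemann_liouville_semigroup[OF Wi BW] \<nu> t by simp
    also have "\<dots> = riemann_liouville \<nu> (riemann_liouville 1 D) t"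
      by (rule riemann_liouville_cong)
        (use integral_unique[OF D] t in \<open>auto simp: riemann_liouville_1\<close>)
    also have "\<dots> = riemann_liouville (1 + \<nu>) D t"
      using riemann_liouville_semigroup[OF Di Db] \<nu> t by (simp add: add.commute)
    also have "\<dots> = riemann_liouville 1 (riemann_liouville \<nu> D) t"
      using riemann_liouville_semigroup[OF Di Db] \<nu> t by simp
    finally show ?thesis by (simp add: riemann_liouville_1)
  qed
  have R: "continuous_on {0..T} (riemann_liouville \<nu> D)"
    using continuous_riemann_liouville[OF Di Db] \<nu> by simp
  show "u t = u 0 + riemann_liouville \<nu> (caputo T \<nu> u) t" if t: "t \<in> {0..T}" for t
  proof -
    \<comment> \<open>One function has both \<open>W t\<close> and the fractional integral of
      \<open>D\<close> as its derivative, and derivatives within a nondegenerate interval are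
      unique.\<close>
    have "((\<lambda>t. integral {0..t} (riemann_liouville \<nu> D)) has_vector_derivative W t) (at t within {0..T})"
      using integral_has_vector_derivative[OF W t]
      by (rule has_vector_derivative_transform[OF t, rotated]) (rule int_eq[symmetric])
    then have "W t = riemann_liouville \<nu> D t"
      using vector_derivative_unique_within_closed_interval[OF T, of t] t
        integral_has_vector_derivative[OF R t] by simp
    then show ?thesis by (simp add: W_def D_def)
  qed
qed

section \<open>Regularity of the coefficients\<close>

text \<open>Since \<open>q - q 0\<close> is the integral of \<open>q'\<close>, the semigroup
  property writes the Caputo integral as \<open>Gamma (1 - \<nu>)\<close> times the integral of
  \<open>d\<close>, the fractional integral of \<open>q'\<close> of order \<open>1 - \<nu>\<close>.
  As \<open>d\<close> is continuous, it is the Caputo derivative.\<close>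

lemma caputo_C1:
  assumes T: "0 < T" and \<nu>: "0 < \<nu>" "\<nu> < 1" and q: "q \<in> C1_space T"
  shows "caputo_differentiable T \<nu> q" "continuous_on {0..T} (caputo T \<nu> q)"
proof -
  obtain q' where q': "continuous_on {0..T} q'"
    "\<And>t. t \<in> {0..T} \<Longrightarrow> (q has_real_derivative q' t) (at t within {0..T})"
    using q by (auto simp: C1_space_def)
  obtain B where B: "\<And>t. t \<in> {0..T} \<Longrightarrow> \<bar>q' t\<bar> \<le> B"
    using continuous_on_Icc_bounded[OF q'(1)] by blast
  note i = absolutely_integrable_continuous_real[OF q'(1)]
  define d where "d = riemann_liouville (1 - \<nu>) q'"
  have d: "continuous_on {0..T} d"
    unfolding d_def using continuous_riemann_liouville[OF i B] \<nu> by simp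
  have "q t - q 0 = riemann_liouville 1 q' t" if "t \<in> {0..T}" for t
  proof -
    have "(q' has_integral q t - q 0) {0..t}"
      using that
      by (intro fundamental_theorem_of_calculus)
        (auto simp: has_real_derivative_iff_has_vector_derivative[symmetric]
          intro!: DERIV_subset[OF q'(2), of _ "{0..t}"])
    then show ?thesis by (simp add: riemann_liouville_1 integral_unique)
  qed
  then have "caputo_integral \<nu> q t = Gamma (1 - \<nu>) * riemann_liouville (1 - \<nu>) (riemann_liouville 1 q') t"
    if "t \<in> {0..T}" for t
    using that unfolding caputo_integral_eq[OF \<nu>(2)]
    by (intro arg_cong2[where f="(*)"] riemann_liouville_cong) auto
  moreover have "riemann_liouville (1 - \<nu>) (riemann_liouville 1 q') t = integral {0..t} d"
    if "t \<in> {0..T}" for t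
  proof -
    have "riemann_liouville (1 - \<nu>) (riemann_liouville 1 q') t = riemann_liouville (1 - \<nu> + 1) q' t"
      using riemann_liouville_semigroup[OF i B, of "1 - \<nu>" 1] \<nu> that by simp
    also have "\<dots> = riemann_liouville 1 d t"
      using riemann_liouville_semigroup[OF i B, of 1 "1 - \<nu>"] \<nu> that
      by (simp add: d_def add.commute[of "1 - \<nu>"])
    finally show ?thesis by (simp add: riemann_liouville_1)
  qed
  ultimately have eq: "Gamma (1 - \<nu>) * integral {0..t} d = caputo_integral \<nu> q t" if "t \<in> {0..T}" for t
    using that by simp
  have der: "(caputo_integral \<nu> q has_real_derivative Gamma (1 - \<nu>) * d t) (at t within {0..T})"
    if "t \<in> {0<..T}" for t
    by (rule has_field_derivative_transform_within[where d=1, OF DERIV_cmult[OF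
          integral_has_real_derivative[OF d]]]) (use that eq in auto)
  show "caputo_differentiable T \<nu> q"
    using caputoI(1)[OF T \<nu>(2) d der] by blast
  show "continuous_on {0..T} (caputo T \<nu> q)"
    using d by (rule continuous_on_eq) (use caputoI(2)[OF T \<nu>(2) d der] in auto)
qed

text \<open>The bound is written with \<open>powr 1\<close> so that a continuously differentiable
  coefficient counts as Hoelder with exponent 1, which exceeds every order \<nu> below 1.\<close>

lemma C1_space_lipschitz:
  assumes "q \<in> C1_space T"
  shows "continuous_on {0..T} q"
    and "\<exists>L. \<forall>s\<in>{0..T}. \<forall>t\<in>{0..T}. \<bar>q t - q s\<bar> \<le> L * \<bar>t - s\<bar> powr 1"
proof -
  obtain q' where q': "continuous_on {0..T} q'"
    "\<And>t. t \<in> {0..T} \<Longrightarrow> (q has_real_derivative q' t) (at t within {0..T})"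
    using assms by (auto simp: C1_space_def)
  obtain B where B: "\<And>t. t \<in> {0..T} \<Longrightarrow> \<bar>q' t\<bar> \<le> B"
    using continuous_on_Icc_bounded[OF q'(1)] by blast
  show "continuous_on {0..T} q"
    using q'(2) by (rule DERIV_continuous_on)
  have "norm (q t - q s) \<le> B * norm (t - s)" if "s \<in> {0..T}" "t \<in> {0..T}" for s t
    by (rule field_differentiable_bound[OF _ q'(2)]) (use that B in auto)
  then show "\<exists>L. \<forall>s\<in>{0..T}. \<forall>t\<in>{0..T}. \<bar>q t - q s\<bar> \<le> L * \<bar>t - s\<bar> powr 1"
    by (intro exI[of _ B]) auto
qed

text \<open>By inversion \<open>u - u 0\<close> is the fractional integral of order \<nu> of a
  bounded function, and such integrals are Hoelder with that exponent.\<close>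

lemma caputo_continuous_imp_holder:
  assumes "0 < T" "0 < \<nu>" "\<nu> < 1" "continuous_on {0..T} u" "caputo_differentiable T \<nu> u"
    and "continuous_on {0..T} (caputo T \<nu> u)"
  shows "\<exists>L. \<forall>s\<in>{0..T}. \<forall>t\<in>{0..T}. \<bar>u t - u s\<bar> \<le> L * \<bar>t - s\<bar> powr \<nu>"
proof -
  obtain B where B: "\<And>t. t \<in> {0..T} \<Longrightarrow> \<bar>caputo T \<nu> u t\<bar> \<le> B"
    using continuous_on_Icc_bounded[OF assms(6)] by blast
  have i: "caputo T \<nu> u absolutely_integrable_on {0..T}"
    using caputo_inversion(1)[OF assms(1-5) B] .
  have inv: "u t = u 0 + riemann_liouville \<nu> (caputo T \<nu> u) t" if "t \<in> {0..T}" for t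
    by (rule caputo_inversion(2)[OF assms(1-5)]) (use B that in auto)
  have "\<bar>u t - u s\<bar> \<le> 2 * B / (\<nu> * Gamma \<nu>) * \<bar>t - s\<bar> powr \<nu>" if "s \<in> {0..T}" "t \<in> {0..T}" for s t
    using riemann_liouville_holder[OF i B assms(2) _ that] assms(3)
    by (simp add: inv[OF that(1)] inv[OF that(2)])
  then show ?thesis by blast
qed

text \<open>Brings the three alternatives to one form: a continuous Caputo derivative and Hoelder
  continuity with an exponent above \<nu>. The exponent is 1 for continuously differentiable
  \<open>q\<close>; in the second alternative it is given and exceeds
  \<open>\<alpha> + \<nu>\<close>; in the third it is the higher order \<open>\<mu>\<close> of a
  continuous Caputo derivative.\<close>

lemma coefficient_regularityD:
  assumes "0 < T" "0 < \<nu>" "\<nu> < 1" "0 < \<alpha>" and reg: "coefficient_regularity \<nu> \<alpha> T q"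
  obtains L \<mu> where "continuous_on {0..T} q" "caputo_differentiable T \<nu> q"
    "continuous_on {0..T} (caputo T \<nu> q)" "\<nu> < \<mu>"
    "\<And>s t. s \<in> {0..T} \<Longrightarrow> t \<in> {0..T} \<Longrightarrow> \<bar>q t - q s\<bar> \<le> L * \<bar>t - s\<bar> powr \<mu>"
proof -
  consider "q \<in> C1_space T"
    | \<mu> \<mu>' where "\<alpha> + \<nu> < \<mu>" "q \<in> holder_space \<mu> T" "q \<in> caputo_holder_space \<nu> \<mu>' T"
    | \<mu> \<mu>' \<mu>1 where "\<nu> < \<mu>" "\<mu> < 1" "q \<in> caputo_holder_space \<mu> \<mu>' T"
        "caputo_differentiable T \<nu> q" "caputo T \<nu> q \<in> holder_space \<mu>1 T"
    using reg unfolding coefficient_regularity_def by auto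
  then show ?thesis
  proof cases
    case 1
    then show ?thesis
      using caputo_C1[OF assms(1-3)] C1_space_lipschitz that[of 1] assms(3) by blast
  next
    case 2
    then show ?thesis
      using that[of \<mu>] assms(4) unfolding holder_space_def caputo_holder_space_def by force
  next
    case 3
    then have "\<exists>L. \<forall>s\<in>{0..T}. \<forall>t\<in>{0..T}. \<bar>q t - q s\<bar> \<le> L * \<bar>t - s\<bar> powr \<mu>"
      using assms by (intro caputo_continuous_imp_holder) (auto simp: caputo_holder_space_def)
    then show ?thesis
      using 3 that[of \<mu>] unfolding holder_space_def caputo_holder_space_def by blast
  qed
qed

subsection \<open>Products with Hoelder continuous coefficients\<close>

text \<open>Mean value theorem; the derivative of \<open>x powr (- \<nu>)\<close> is largest in
  absolute value at the left end \<open>y\<close>. With \<open>y = s - x\<close> and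
  \<open>z = t - x\<close> this controls the kernel when its singularity moves from \<open>s\<close>
  to \<open>t\<close>.\<close>

lemma powr_minus_diff_le:
  fixes y z \<nu> :: real
  assumes "0 < y" "y \<le> z" "0 < \<nu>"
  shows "\<bar>z powr (- \<nu>) - y powr (- \<nu>)\<bar> \<le> \<nu> * (z - y) * y powr (- \<nu> - 1)"
proof (cases "y = z")
  case False
  have "\<exists>\<xi>>y. \<xi> < z \<and> z powr (- \<nu>) - y powr (- \<nu>) = (z - y) * (- \<nu> * \<xi> powr (- \<nu> - 1))"
    using assms False by (intro MVT2) (auto intro!: derivative_eq_intros)
  then obtain \<xi> where \<xi>: "y < \<xi>" "z powr (- \<nu>) - y powr (- \<nu>) = (z - y) * (- \<nu> * \<xi> powr (- \<nu> - 1))"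
    by blast
  have "\<xi> powr (- \<nu> - 1) \<le> y powr (- \<nu> - 1)"
    using assms \<xi>(1) by (intro powr_mono2') auto
  then show ?thesis
    unfolding \<xi>(2) using assms by (simp add: abs_mult mult_ac mult_left_mono)
qed (use assms in auto)

text \<open>The increment of the left-hand integral is compared with \<open>q s\<close> times the increment of the
  integral without \<open>q\<close>; the vanishing of \<open>q x - q s\<close> at \<open>x = s\<close> compensates the singularity of the
  differentiated kernel.\<close>

lemma holder_times_kernel_lipschitz:
  fixes q w :: "real \<Rightarrow> real"
  assumes \<nu>: "0 < \<nu>" "\<nu> < 1" and \<mu>: "\<nu> < \<mu>"
    and q: "continuous_on {0..T} q" and w: "continuous_on {0..T} w"
    and hol: "\<And>s t. s \<in> {0..T} \<Longrightarrow> t \<in> {0..T} \<Longrightarrow> \<bar>q t - q s\<bar> \<le> L * \<bar>t - s\<bar> powr \<mu>"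
    and lip: "\<And>s t. s \<in> {0..T} \<Longrightarrow> t \<in> {0..T} \<Longrightarrow>
      \<bar>integral {0..t} (\<lambda>x. (t - x) powr (- \<nu>) * w x) - integral {0..s} (\<lambda>x. (s - x) powr (- \<nu>) * w x)\<bar>
        \<le> C * \<bar>t - s\<bar>"
  shows "\<exists>C'. \<forall>s\<in>{0..T}. \<forall>t\<in>{0..T}.
      \<bar>integral {0..t} (\<lambda>x. (t - x) powr (- \<nu>) * (q x * w x))
        - integral {0..s} (\<lambda>x. (s - x) powr (- \<nu>) * (q x * w x))\<bar> \<le> C' * \<bar>t - s\<bar>"
proof -
  obtain Q where Q: "0 \<le> Q" "\<And>x. x \<in> {0..T} \<Longrightarrow> \<bar>q x\<bar> \<le> Q"
    using continuous_on_Icc_bounded[OF q] by blast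
  obtain W where W: "0 \<le> W" "\<And>x. x \<in> {0..T} \<Longrightarrow> \<bar>w x\<bar> \<le> W"
    using continuous_on_Icc_bounded[OF w] by blast
  define A where "A = (\<lambda>t. integral {0..t} (\<lambda>x. (t - x) powr (- \<nu>) * w x))"
  define E where "E = (\<lambda>t. integral {0..t} (\<lambda>x. (t - x) powr (- \<nu>) * (q x * w x)))"
  \<comment> \<open>\<open>C1\<close> bounds the contribution of \<open>{s..t}\<close> and
    \<open>C2\<close> that of \<open>{0..s}\<close>, each after division by \<open>t - s\<close>; a
    further \<open>Q * C\<close> comes from the increment of \<open>A\<close>.\<close>
  define C1 where "C1 = \<bar>L\<bar> * W * T powr (\<mu> - \<nu>) / (1 - \<nu>)"
  define C2 where "C2 = \<nu> * \<bar>L\<bar> * W * T powr (\<mu> - \<nu>) / (\<mu> - \<nu>)"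
  have ki: "(\<lambda>x. (t - x) powr (- \<nu>) * g x) integrable_on {a..b}"
    if g: "continuous_on {a..b} g" and "b \<le> t" for t g a b
  proof -
    obtain B where "\<And>x. x \<in> {a..b} \<Longrightarrow> \<bar>g x\<bar> \<le> B"
      using continuous_on_Icc_bounded[OF g] by blast
    from kernel_times_bounded_absolutely_integrable[OF _ that(2) absolutely_integrable_continuous_real[OF g] this,
        of "1 - \<nu>"]
    show ?thesis using \<nu> by (simp add: absolutely_integrable_on_def)
  qed
  have main: "\<bar>E t - E s\<bar> \<le> (C1 + C2 + Q * C) * (t - s)" if st: "0 \<le> s" "s \<le> t" "t \<le> T" for s t
  proof -
    define g where "g = (\<lambda>x. (q x - q s) * w x)"
    have g: "continuous_on {0..T} g"
      unfolding g_def using q w by (intro continuous_intros)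
    have sub: "continuous_on {a..b} g" if "0 \<le> a" "b \<le> T" for a b
      using g by (rule continuous_on_subset) (use that in auto)
    have gE: "integral {0..u} (\<lambda>x. (u - x) powr (- \<nu>) * g x) = E u - q s * A u" if "0 \<le> u" "u \<le> T" for u
    proof -
      have c: "continuous_on {0..u} q" "continuous_on {0..u} w"
        using that by (auto intro: continuous_on_subset[OF q] continuous_on_subset[OF w])
      have "integral {0..u} (\<lambda>x. (u - x) powr (- \<nu>) * g x)
          = integral {0..u} (\<lambda>x. (u - x) powr (- \<nu>) * (q x * w x) - q s * ((u - x) powr (- \<nu>) * w x))"
        by (simp add: g_def algebra_simps)
      also have "\<dots> = E u - q s * A u"
        unfolding E_def A_def
        by (subst integral_diff) (auto intro!: ki c continuous_on_mult integrable_on_mult_right)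
      finally show ?thesis .
    qed
    have split: "integral {0..t} (\<lambda>x. (t - x) powr (- \<nu>) * g x)
        = integral {0..s} (\<lambda>x. (t - x) powr (- \<nu>) * g x) + integral {s..t} (\<lambda>x. (t - x) powr (- \<nu>) * g x)"
      using st by (intro Henstock_Kurzweil_Integration.integral_combine[symmetric] ki sub) auto
    have first: "\<bar>integral {s..t} (\<lambda>x. (t - x) powr (- \<nu>) * g x)\<bar> \<le> C1 * (t - s)"
    proof -
      have "\<bar>g x\<bar> \<le> \<bar>L\<bar> * (t - s) powr \<mu> * W" if "x \<in> {s..t}" for x
      proof -
        have "\<bar>q x - q s\<bar> \<le> L * \<bar>x - s\<bar> powr \<mu>"
          using that st by (intro hol) auto
        also have "\<dots> \<le> \<bar>L\<bar> * (t - s) powr \<mu>"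
          using that st \<nu> \<mu> by (intro mult_mono powr_mono2) auto
        finally show ?thesis
          unfolding g_def abs_mult using W that st by (intro mult_mono) auto
      qed
      then have "\<bar>integral {s..t} (\<lambda>x. (t - x) powr (1 - \<nu> - 1) * g x)\<bar>
          \<le> \<bar>L\<bar> * (t - s) powr \<mu> * W * (t - s) powr (1 - \<nu>) / (1 - \<nu>)"
        using \<nu> st by (intro kernel_integral_bound absolutely_integrable_continuous_real sub) auto
      \<comment> \<open>Of the total exponent \<open>\<mu> + 1 - \<nu>\<close> one power is kept as
        the Lipschitz factor; the remaining \<open>\<mu> - \<nu>\<close> is positive and is absorbed
        into a power of \<open>T\<close>.\<close>
      also have "\<dots> = \<bar>L\<bar> * W * (t - s) powr (\<mu> - \<nu>) / (1 - \<nu>) * (t - s)"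
      proof -
        have "h powr \<mu> * h powr (1 - \<nu>) = h powr (\<mu> - \<nu>) * h" if "0 \<le> h" for h :: real
          using that powr_add[of h "\<mu> - \<nu>" 1] powr_add[of h \<mu> "1 - \<nu>"] by (simp add: algebra_simps)
        from this[of "t - s"] show ?thesis using st by (simp add: mult_ac)
      qed
      also have "\<dots> \<le> C1 * (t - s)"
        unfolding C1_def using \<nu> \<mu> st W
        by (intro mult_right_mono divide_right_mono mult_left_mono powr_mono2) auto
      finally show ?thesis by simp
    qed
    have second: "\<bar>integral {0..s} (\<lambda>x. (t - x) powr (- \<nu>) * g x - (s - x) powr (- \<nu>) * g x)\<bar>
        \<le> C2 * (t - s)"
    proof -
      have "\<bar>integral {0..s} (\<lambda>x. (t - x) powr (- \<nu>) * g x - (s - x) powr (- \<nu>) * g x)\<bar>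
        \<le> \<nu> * (t - s) * \<bar>L\<bar> * W * ((s - 0) powr (\<mu> - \<nu>) / (\<mu> - \<nu>))"
      proof (rule abs_integral_le_except_endpoint)
        show "(\<lambda>x. (t - x) powr (- \<nu>) * g x - (s - x) powr (- \<nu>) * g x) integrable_on {0..s}"
          using st by (intro integrable_diff ki sub) auto
        \<comment> \<open>The exponent \<open>\<mu> - \<nu> - 1\<close> is above -1 because
          \<open>\<nu> < \<mu>\<close>, so the singularity at \<open>s\<close> is
          integrable.\<close>
        show "((\<lambda>x. \<nu> * (t - s) * \<bar>L\<bar> * W * (s - x) powr (\<mu> - \<nu> - 1)) has_integral
            \<nu> * (t - s) * \<bar>L\<bar> * W * ((s - 0) powr (\<mu> - \<nu>) / (\<mu> - \<nu>))) {0..s}"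
          using st \<mu> by (intro has_integral_mult_right kernel_has_integral) auto
        show "\<bar>(t - x) powr (- \<nu>) * g x - (s - x) powr (- \<nu>) * g x\<bar>
            \<le> \<nu> * (t - s) * \<bar>L\<bar> * W * (s - x) powr (\<mu> - \<nu> - 1)" if x: "x \<in> {0..<s}" for x
        proof -
          have k: "\<bar>(t - x) powr (- \<nu>) - (s - x) powr (- \<nu>)\<bar>
              \<le> \<nu> * (t - s) * (s - x) powr (- \<nu> - 1)"
            using powr_minus_diff_le[of "s - x" "t - x" \<nu>] x st \<nu> by simp
          have "\<bar>q x - q s\<bar> \<le> L * \<bar>x - s\<bar> powr \<mu>"
            using x st by (intro hol) auto
          also have "\<dots> \<le> \<bar>L\<bar> * (s - x) powr \<mu>"
            using x by (intro mult_mono) auto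
          finally have "\<bar>g x\<bar> \<le> \<bar>L\<bar> * (s - x) powr \<mu> * W"
            unfolding g_def abs_mult using W x st by (intro mult_mono) auto
          with k have "\<bar>(t - x) powr (- \<nu>) - (s - x) powr (- \<nu>)\<bar> * \<bar>g x\<bar>
              \<le> (\<nu> * (t - s) * (s - x) powr (- \<nu> - 1)) * (\<bar>L\<bar> * (s - x) powr \<mu> * W)"
            using \<nu> st by (intro mult_mono) auto
          also have "\<dots> = \<nu> * (t - s) * \<bar>L\<bar> * W * ((s - x) powr (- \<nu> - 1) * (s - x) powr \<mu>)"
            by simp
          also have "(s - x) powr (- \<nu> - 1) * (s - x) powr \<mu> = (s - x) powr (\<mu> - \<nu> - 1)"
            by (simp add: powr_add[symmetric] algebra_simps)
          finally show ?thesis by (simp add: abs_mult left_diff_distrib[symmetric])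
        qed
      qed
      also have "\<dots> = \<nu> * \<bar>L\<bar> * W * s powr (\<mu> - \<nu>) / (\<mu> - \<nu>) * (t - s)"
        by simp
      also have "\<dots> \<le> C2 * (t - s)"
        unfolding C2_def using \<nu> \<mu> st W
        by (intro mult_right_mono divide_right_mono mult_left_mono powr_mono2) auto
      finally show ?thesis .
    qed
    have "integral {0..s} (\<lambda>x. (t - x) powr (- \<nu>) * g x - (s - x) powr (- \<nu>) * g x)
        = integral {0..s} (\<lambda>x. (t - x) powr (- \<nu>) * g x) - integral {0..s} (\<lambda>x. (s - x) powr (- \<nu>) * g x)"
      using st by (intro integral_diff ki sub) auto
    \<comment> \<open>In \<open>g\<close> the factor \<open>q\<close> is replaced by
      \<open>q - q s\<close>; what this removes is \<open>q s\<close> times the increment of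
      \<open>A\<close>, to which the Lipschitz hypothesis applies.\<close>
    then have "E t - E s = integral {s..t} (\<lambda>x. (t - x) powr (- \<nu>) * g x)
        + integral {0..s} (\<lambda>x. (t - x) powr (- \<nu>) * g x - (s - x) powr (- \<nu>) * g x) + q s * (A t - A s)"
      using split gE[of t] gE[of s] st by (simp add: algebra_simps)
    moreover have "\<bar>q s * (A t - A s)\<bar> \<le> Q * (C * (t - s))"
      unfolding abs_mult using Q(2)[of s] lip[of s t] st Q(1) by (intro mult_mono) (auto simp: A_def)
    ultimately show ?thesis
      using first second by (simp add: algebra_simps)
  qed
  have "\<bar>E t - E s\<bar> \<le> (C1 + C2 + Q * C) * \<bar>t - s\<bar>" if "s \<in> {0..T}" "t \<in> {0..T}" for s t
    using main[of s t] main[of t s] that by (cases "s \<le> t") (auto simp: abs_minus_commute)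
  then show ?thesis unfolding E_def by blast
qed

lemma lipschitz_imp_derivative_bound:
  fixes f :: "real \<Rightarrow> real"
  assumes "(f has_real_derivative d) (at t within {a..b})" "a < b" "t \<in> {a..b}"
    and "\<And>s. s \<in> {a..b} \<Longrightarrow> \<bar>f s - f t\<bar> \<le> C * \<bar>s - t\<bar>"
  shows "\<bar>d\<bar> \<le> C"
proof (rule tendsto_upperbound)
  show "((\<lambda>s. \<bar>(f s - f t) / (s - t)\<bar>) \<longlongrightarrow> \<bar>d\<bar>) (at t within {a..b})"
    using assms(1) by (intro tendsto_rabs) (simp add: has_field_derivative_iff)
  show "\<forall>\<^sub>F s in at t within {a..b}. \<bar>(f s - f t) / (s - t)\<bar> \<le> C"
    using assms(4) by (auto simp: eventually_at_filter abs_divide divide_le_eq)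
  show "at t within {a..b} \<noteq> bot"
    using assms(2,3) by (simp add: trivial_limit_within islimpt_Icc)
qed

lemma caputo_integral_lipschitz:
  assumes "0 < \<nu>" "\<nu> < 1" "continuous_on {0..T} u" "caputo_differentiable T \<nu> u"
    and bd: "\<And>t. t \<in> {0..T} \<Longrightarrow> \<bar>caputo T \<nu> u t\<bar> \<le> B" and "s \<in> {0..T}" "t \<in> {0..T}"
  shows "\<bar>caputo_integral \<nu> u t - caputo_integral \<nu> u s\<bar> \<le> Gamma (1 - \<nu>) * B * \<bar>t - s\<bar>"
  using assms(6,7)
proof (induction s t rule: linorder_wlog)
  case (sym s t)
  then show ?case by (simp add: abs_minus_commute)
next
  case (le s t)
  show ?case
  proof (cases "s = t")
    case False
    then have "s < t" using le by simp
    moreover have "continuous_on {s..t} (caputo_integral \<nu> u)"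
      by (rule continuous_on_subset[OF continuous_on_caputo_integral[OF assms(1-3)]]) (use le in auto)
    moreover have "(caputo_integral \<nu> u has_derivative (\<lambda>h. h * (Gamma (1 - \<nu>) * caputo T \<nu> u x))) (at x)"
      if "s < x" "x < t" for x
      using caputo_has_derivative[OF assms(2,4), of x] that le
      by (simp add: at_within_Icc_at has_field_derivative_def mult.commute[of _ "Gamma (1 - \<nu>) * _"])
    \<comment> \<open>The intermediate point is strictly positive, so the value of
      \<open>caputo\<close> there is a true derivative and not the limit at 0.\<close>
    ultimately obtain x where x: "s < x" "x < t"
      "caputo_integral \<nu> u t - caputo_integral \<nu> u s = (t - s) * (Gamma (1 - \<nu>) * caputo T \<nu> u x)"
      by (rule mvt) auto
    have "\<bar>caputo T \<nu> u x\<bar> \<le> B"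
      using x le by (intro bd) auto
    then show ?thesis
      unfolding x(3) using Gamma_real_pos[of "1 - \<nu>"] assms(2)
        mult_right_mono[of "\<bar>caputo T \<nu> u x\<bar>" B "\<bar>t - s\<bar>"]
      by (simp add: abs_mult mult_ac)
  qed simp
qed

text \<open>Rests on \<open>q x * v x - q 0 * v 0 = q x * (v x - v 0) + v 0 * (q x - q 0)\<close>.
  The first summand is small near 0, the second carries the Caputo integral of
  \<open>q\<close>.\<close>

lemma caputo_integral_product:
  assumes "\<nu> < 1" "continuous_on {0..t} q" "continuous_on {0..t} v"
  shows "caputo_integral \<nu> (\<lambda>s. q s * v s) t
    = integral {0..t} (\<lambda>x. (t - x) powr (- \<nu>) * (q x * (v x - v 0))) + v 0 * caputo_integral \<nu> q t"
proof -
  have ki: "(\<lambda>x. (t - x) powr (- \<nu>) * g x) integrable_on {0..t}" if g: "continuous_on {0..t} g" for g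
  proof -
    obtain B where "\<And>x. x \<in> {0..t} \<Longrightarrow> \<bar>g x\<bar> \<le> B"
      using continuous_on_Icc_bounded[OF g] by blast
    from kernel_times_bounded_absolutely_integrable[OF _ order_refl absolutely_integrable_continuous_real[OF g] this,
        of "1 - \<nu>"]
    show ?thesis using assms by (simp add: absolutely_integrable_on_def)
  qed
  have "caputo_integral \<nu> (\<lambda>s. q s * v s) t
      = integral {0..t} (\<lambda>x. (t - x) powr (- \<nu>) * (q x * (v x - v 0))
          + v 0 * ((t - x) powr (- \<nu>) * (q x - q 0)))"
    unfolding caputo_integral_eq_integral by (simp add: algebra_simps)
  also have "\<dots> = integral {0..t} (\<lambda>x. (t - x) powr (- \<nu>) * (q x * (v x - v 0)))
      + v 0 * caputo_integral \<nu> q t"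
    unfolding caputo_integral_eq_integral using assms
    by (subst integral_add) (auto intro!: ki integrable_on_mult_right continuous_intros)
  finally show ?thesis .
qed

text \<open>Both parts of the Caputo integral of the product are Lipschitz: the one with
  \<open>v - v 0\<close> because \<open>q\<close> has a Hoelder exponent above \<nu>, the other
  because the Caputo derivative of \<open>q\<close> is bounded. A Lipschitz constant bounds the
  derivative.\<close>

lemma caputo_product_bounded:
  assumes T: "0 < T" and \<nu>: "0 < \<nu>" "\<nu> < 1" and \<mu>: "\<nu> < \<mu>"
    and q: "continuous_on {0..T} q" "caputo_differentiable T \<nu> q" "continuous_on {0..T} (caputo T \<nu> q)"
    and hol: "\<And>s t. s \<in> {0..T} \<Longrightarrow> t \<in> {0..T} \<Longrightarrow> \<bar>q t - q s\<bar> \<le> L * \<bar>t - s\<bar> powr \<mu>"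
    and v: "continuous_on {0..T} v" "caputo_differentiable T \<nu> v" "continuous_on {0..T} (caputo T \<nu> v)"
    and qv: "caputo_differentiable T \<nu> (\<lambda>s. q s * v s)"
  shows "\<exists>B. \<forall>t\<in>{0..T}. \<bar>caputo T \<nu> (\<lambda>s. q s * v s) t\<bar> \<le> B"
proof -
  define J where "J = caputo_integral \<nu> (\<lambda>s. q s * v s)"
  define E where "E = (\<lambda>t. integral {0..t} (\<lambda>x. (t - x) powr (- \<nu>) * (q x * (v x - v 0))))"
  obtain BQ where BQ: "\<And>x. x \<in> {0..T} \<Longrightarrow> \<bar>caputo T \<nu> q x\<bar> \<le> BQ"
    using continuous_on_Icc_bounded[OF q(3)] by blast
  obtain BV where BV: "\<And>x. x \<in> {0..T} \<Longrightarrow> \<bar>caputo T \<nu> v x\<bar> \<le> BV"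
    using continuous_on_Icc_bounded[OF v(3)] by blast
  have w: "continuous_on {0..T} (\<lambda>x. v x - v 0)"
    using v by (intro continuous_intros)
  have "\<exists>C'. \<forall>s\<in>{0..T}. \<forall>t\<in>{0..T}. \<bar>E t - E s\<bar> \<le> C' * \<bar>t - s\<bar>"
    unfolding E_def
    by (rule holder_times_kernel_lipschitz[OF \<nu> \<mu> q(1) w hol
          caputo_integral_lipschitz[OF \<nu> v(1,2) BV, unfolded caputo_integral_eq_integral]])
  then obtain CE where CE: "\<And>s t. s \<in> {0..T} \<Longrightarrow> t \<in> {0..T} \<Longrightarrow> \<bar>E t - E s\<bar> \<le> CE * \<bar>t - s\<bar>"
    by blast
  have JE: "J t = E t + v 0 * caputo_integral \<nu> q t" if t: "t \<in> {0..T}" for t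
    unfolding J_def E_def by (rule caputo_integral_product) (use t q v \<nu> continuous_on_subset[of "{0..T}" _ "{0..t}"] in auto)
  define C where "C = CE + \<bar>v 0\<bar> * (Gamma (1 - \<nu>) * BQ)"
  have JL: "\<bar>J s - J t\<bar> \<le> C * \<bar>s - t\<bar>" if "s \<in> {0..T}" "t \<in> {0..T}" for s t
  proof -
    have "\<bar>v 0\<bar> * \<bar>caputo_integral \<nu> q s - caputo_integral \<nu> q t\<bar> \<le> \<bar>v 0\<bar> * (Gamma (1 - \<nu>) * BQ * \<bar>s - t\<bar>)"
      by (intro mult_left_mono caputo_integral_lipschitz[OF \<nu> q(1,2) BQ]) (use that in auto)
    moreover have "\<bar>E s - E t\<bar> \<le> CE * \<bar>s - t\<bar>"
      using CE that by blast
    moreover have "J s - J t = (E s - E t) + v 0 * (caputo_integral \<nu> q s - caputo_integral \<nu> q t)"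
      using JE that by (simp add: algebra_simps)
    ultimately show ?thesis
      unfolding C_def abs_mult[symmetric] by (simp add: algebra_simps)
  qed
  have "\<bar>caputo T \<nu> (\<lambda>s. q s * v s) t\<bar> \<le> C / Gamma (1 - \<nu>)" if "t \<in> {0<..T}" for t
  proof -
    have "\<bar>Gamma (1 - \<nu>) * caputo T \<nu> (\<lambda>s. q s * v s) t\<bar> \<le> C"
      by (rule lipschitz_imp_derivative_bound[OF caputo_has_derivative[OF \<nu>(2) qv that] T])
        (use JL that in \<open>auto simp: J_def\<close>)
    then show ?thesis
      using Gamma_real_pos[of "1 - \<nu>"] \<nu> by (simp add: abs_mult field_simps)
  qed
  \<comment> \<open>The Lipschitz bound covers positive \<open>t\<close>; the value at 0 is a limit
    and is included in the maximum.\<close>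
  then have "\<bar>caputo T \<nu> (\<lambda>s. q s * v s) t\<bar>
      \<le> max (C / Gamma (1 - \<nu>)) \<bar>caputo T \<nu> (\<lambda>s. q s * v s) 0\<bar>" if "t \<in> {0..T}" for t
    using that by (cases "t = 0") (auto simp: le_max_iff_disj)
  then show ?thesis by blast
qed

subsection \<open>Behaviour at the origin\<close>

text \<open>The integral is O(t^(\<beta> + 1 - \<nu>)), so its quotient by \<open>t\<close> is
  O(t^(\<beta> - \<nu>)) with a positive exponent.\<close>

lemma kernel_integral_div_tendsto_0:
  fixes g :: "real \<Rightarrow> real"
  assumes "0 < T" "\<nu> < 1" "\<nu> < \<beta>" "0 \<le> \<beta>" and g: "continuous_on {0..T} g"
    and bd: "\<And>t. t \<in> {0..T} \<Longrightarrow> \<bar>g t\<bar> \<le> C * t powr \<beta>"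
  shows "((\<lambda>t. integral {0..t} (\<lambda>x. (t - x) powr (- \<nu>) * g x) / t) \<longlongrightarrow> 0) (at_right 0)"
proof (rule Lim_null_comparison)
  show "((\<lambda>t. \<bar>C\<bar> / (1 - \<nu>) * t powr (\<beta> - \<nu>)) \<longlongrightarrow> 0) (at_right 0)"
    using assms by (intro tendsto_mult_right_zero tendsto_eq_intros tendsto_powr')
      (auto simp: eventually_at_filter)
  show "\<forall>\<^sub>F t in at_right 0. norm (integral {0..t} (\<lambda>x. (t - x) powr (- \<nu>) * g x) / t)
      \<le> \<bar>C\<bar> / (1 - \<nu>) * t powr (\<beta> - \<nu>)"
    using eventually_at_right_0_Ioo[OF assms(1)]
  proof eventually_elim
    case (elim t)
    have "\<bar>integral {0..t} (\<lambda>x. (t - x) powr (1 - \<nu> - 1) * g x)\<bar>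
        \<le> \<bar>C\<bar> * t powr \<beta> * (t - 0) powr (1 - \<nu>) / (1 - \<nu>)"
    proof (rule kernel_integral_bound)
      show "g absolutely_integrable_on {0..t}"
        by (intro absolutely_integrable_continuous_real continuous_on_subset[OF g]) (use elim in auto)
      show "\<bar>g x\<bar> \<le> \<bar>C\<bar> * t powr \<beta>" if "x \<in> {0..t}" for x
      proof -
        have "\<bar>g x\<bar> \<le> C * x powr \<beta>"
          using that elim by (intro bd) auto
        also have "\<dots> \<le> \<bar>C\<bar> * t powr \<beta>"
          using that assms by (intro mult_mono powr_mono2) auto
        finally show ?thesis .
      qed
    qed (use elim assms in auto)
    moreover have "t powr \<beta> * t powr (1 - \<nu>) = t powr (\<beta> - \<nu>) * t"
      using elim powr_add[of t "\<beta> - \<nu>" 1] powr_add[of t \<beta> "1 - \<nu>"] by (simp add: algebra_simps)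
    ultimately have "\<bar>integral {0..t} (\<lambda>x. (t - x) powr (- \<nu>) * g x)\<bar>
        \<le> \<bar>C\<bar> / (1 - \<nu>) * t powr (\<beta> - \<nu>) * t"
      by (simp add: mult.assoc)
    then show ?case
      using elim by (simp add: pos_divide_le_eq)
  qed
qed

text \<open>The Caputo integral divided by \<open>t\<close> tends to 0 by the size of
  \<open>v - v 0\<close>, and to a nonzero multiple of the Caputo value by l'Hopital. This removes
  the lower order terms of the type I operator at 0.\<close>

lemma caputo_at_0_eq_0:
  assumes "0 < T" "0 < \<nu>" "\<nu> < 1" "\<nu> < \<beta>" "continuous_on {0..T} v" "caputo_differentiable T \<nu> v"
    and "\<And>t. t \<in> {0..T} \<Longrightarrow> \<bar>v t - v 0\<bar> \<le> C * t powr \<beta>"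
  shows "caputo T \<nu> v 0 = 0"
proof -
  have "((\<lambda>t. caputo_integral \<nu> v t / t) \<longlongrightarrow> 0) (at_right 0)"
    unfolding caputo_integral_eq_integral
    by (rule kernel_integral_div_tendsto_0[where \<beta> = \<beta> and T = T and C = C])
      (use assms in \<open>auto intro!: continuous_intros\<close>)
  from tendsto_unique[OF _ this caputo_integral_div_tendsto[OF assms(1-3,5,6)]]
  show ?thesis using Gamma_one_minus_nonzero[OF assms(3)] by simp
qed

text \<open>Computes in two ways the limit of the Caputo integral of the product divided by
  \<open>t\<close>: the part with \<open>v - v 0\<close> disappears, since \<open>q\<close> is
  bounded and \<open>\<nu> < \<beta>\<close>, and the rest is \<open>v 0\<close> times the quotient
  for \<open>q\<close>.\<close>

lemma caputo_product_at_0: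
  assumes "0 < T" "0 < \<nu>" "\<nu> < 1" "\<nu> < \<beta>" and q: "continuous_on {0..T} q" "caputo_differentiable T \<nu> q"
    and v: "continuous_on {0..T} v" and qv: "caputo_differentiable T \<nu> (\<lambda>s. q s * v s)"
    and bd: "\<And>t. t \<in> {0..T} \<Longrightarrow> \<bar>v t - v 0\<bar> \<le> C * t powr \<beta>"
  shows "caputo T \<nu> (\<lambda>s. q s * v s) 0 = v 0 * caputo T \<nu> q 0"
proof -
  let ?J = "caputo_integral \<nu> (\<lambda>s. q s * v s)"
  let ?E = "\<lambda>t. integral {0..t} (\<lambda>x. (t - x) powr (- \<nu>) * (q x * (v x - v 0)))"
  obtain Q where Q: "0 \<le> Q" "\<And>x. x \<in> {0..T} \<Longrightarrow> \<bar>q x\<bar> \<le> Q"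
    using continuous_on_Icc_bounded[OF q(1)] by blast
  have "\<bar>q t * (v t - v 0)\<bar> \<le> Q * C * t powr \<beta>" if "t \<in> {0..T}" for t
    unfolding abs_mult mult.assoc using Q bd that by (intro mult_mono) auto
  then have "((\<lambda>t. ?E t / t) \<longlongrightarrow> 0) (at_right 0)"
    by (intro kernel_integral_div_tendsto_0[where \<beta> = \<beta> and T = T])
      (use assms in \<open>auto intro!: continuous_intros\<close>)
  moreover have "((\<lambda>t. caputo_integral \<nu> q t / t) \<longlongrightarrow> Gamma (1 - \<nu>) * caputo T \<nu> q 0) (at_right 0)"
    by (rule caputo_integral_div_tendsto[OF assms(1-3) q])
  ultimately have lim: "((\<lambda>t. ?E t / t + v 0 * (caputo_integral \<nu> q t / t))
      \<longlongrightarrow> 0 + v 0 * (Gamma (1 - \<nu>) * caputo T \<nu> q 0)) (at_right 0)"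
    by (intro tendsto_intros)
  have ev: "\<forall>\<^sub>F t in at_right 0. ?E t / t + v 0 * (caputo_integral \<nu> q t / t) = ?J t / t"
    using eventually_at_right_0_Ioo[OF assms(1)]
  proof eventually_elim
    case (elim t)
    have "?J t = ?E t + v 0 * caputo_integral \<nu> q t"
      by (intro caputo_integral_product continuous_on_subset[OF q(1)] continuous_on_subset[OF v])
        (use elim assms(3) in auto)
    then show ?case by (simp add: add_divide_distrib)
  qed
  have "((\<lambda>t. ?J t / t) \<longlongrightarrow> 0 + v 0 * (Gamma (1 - \<nu>) * caputo T \<nu> q 0)) (at_right 0)"
    by (rule Lim_transform_eventually[OF lim ev])
  moreover have "continuous_on {0..T} (\<lambda>s. q s * v s)"
    using q(1) v by (intro continuous_intros)
  then have "((\<lambda>t. ?J t / t) \<longlongrightarrow> Gamma (1 - \<nu>) * caputo T \<nu> (\<lambda>s. q s * v s) 0) (at_right 0)"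
    by (rule caputo_integral_div_tendsto[OF assms(1-3) _ qv])
  ultimately have "0 + v 0 * (Gamma (1 - \<nu>) * caputo T \<nu> q 0) = Gamma (1 - \<nu>) * caputo T \<nu> (\<lambda>s. q s * v s) 0"
    by (rule tendsto_unique[OF trivial_limit_at_right_real])
  then show ?thesis using Gamma_one_minus_nonzero[OF assms(3)] by simp
qed

section \<open>Representation and recovery of the order\<close>

text \<open>The inversion formula with D written as \<open>D 0\<close> plus the rest: the constant
  integrates to \<open>D 0 * (t powr \<nu> / \<nu>)\<close>, and
  \<open>Gamma (1 + \<nu>) = \<nu> * Gamma \<nu>\<close> gives its coefficient.\<close>

lemma caputo_representation:
  assumes T: "0 < T" and \<nu>: "0 < \<nu>" "\<nu> < 1" and u: "continuous_on {0..T} u"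
    and cd: "caputo_differentiable T \<nu> u" and bd: "\<And>t. t \<in> {0..T} \<Longrightarrow> \<bar>caputo T \<nu> u t\<bar> \<le> B"
    and t: "t \<in> {0..T}"
  shows "(\<lambda>\<tau>. (t - \<tau>) powr (\<nu> - 1) * (caputo T \<nu> u \<tau> - caputo T \<nu> u 0)) absolutely_integrable_on {0..t}"
    and "u t = u 0 + caputo T \<nu> u 0 / Gamma (1 + \<nu>) * t powr \<nu>
      + 1 / Gamma \<nu> * integral {0..t} (\<lambda>\<tau>. (t - \<tau>) powr (\<nu> - 1) * (caputo T \<nu> u \<tau> - caputo T \<nu> u 0))"
proof -
  define D where "D = caputo T \<nu> u"
  have inv: "u t = u 0 + riemann_liouville \<nu> (caputo T \<nu> u) t"
    by (rule caputo_inversion(2)[OF T \<nu> u cd]) (use bd t in auto)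
  have Di: "D absolutely_integrable_on {0..t}"
    unfolding D_def by (rule absolutely_integrable_on_subinterval[OF caputo_inversion(1)[OF T \<nu> u cd bd]]) (use t in auto)
  have "(\<lambda>\<tau>. D \<tau> - D 0) absolutely_integrable_on {0..t}"
    using Di by (intro set_integral_diff) auto
  moreover have "\<bar>D \<tau> - D 0\<bar> \<le> 2 * B" if "\<tau> \<in> {0..t}" for \<tau>
    using bd[of \<tau>] bd[of 0] that t by (simp add: D_def)
  ultimately show ai: "(\<lambda>\<tau>. (t - \<tau>) powr (\<nu> - 1) * (caputo T \<nu> u \<tau> - caputo T \<nu> u 0))
      absolutely_integrable_on {0..t}"
    unfolding D_def using kernel_times_bounded_absolutely_integrable[OF \<nu>(1) order_refl] by blast
  have "((\<lambda>\<tau>. D 0 * (t - \<tau>) powr (\<nu> - 1) + (t - \<tau>) powr (\<nu> - 1) * (D \<tau> - D 0)) has_integral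
      D 0 * ((t - 0) powr \<nu> / \<nu>) + integral {0..t} (\<lambda>\<tau>. (t - \<tau>) powr (\<nu> - 1) * (D \<tau> - D 0))) {0..t}"
    using ai t \<nu> by (intro has_integral_add has_integral_mult_right kernel_has_integral)
      (auto simp: D_def absolutely_integrable_on_def)
  then have "integral {0..t} (\<lambda>\<tau>. (t - \<tau>) powr (\<nu> - 1) * D \<tau>)
      = D 0 * (t powr \<nu> / \<nu>) + integral {0..t} (\<lambda>\<tau>. (t - \<tau>) powr (\<nu> - 1) * (D \<tau> - D 0))"
    by (intro integral_unique) (simp add: algebra_simps)
  moreover have "Gamma (1 + \<nu>) = \<nu> * Gamma \<nu>"
    using Gamma_plus1[of \<nu>] \<nu> nonpos_Ints_nonpos[of \<nu>] by (force simp: add.commute)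
  ultimately show "u t = u 0 + caputo T \<nu> u 0 / Gamma (1 + \<nu>) * t powr \<nu>
      + 1 / Gamma \<nu> * integral {0..t} (\<lambda>\<tau>. (t - \<tau>) powr (\<nu> - 1) * (caputo T \<nu> u \<tau> - caputo T \<nu> u 0))"
    using inv by (simp add: riemann_liouville_def D_def add_divide_distrib)
qed

text \<open>The remainder of the representation involves only values of \<open>D\<close> on
  \<open>{0..t}\<close>, which are close to \<open>D 0\<close> for small \<open>t\<close>; it is
  therefore at most a small multiple of \<open>t powr \<nu>\<close>.\<close>

lemma caputo_increment_asymptotics:
  assumes T: "0 < T" and \<nu>: "0 < \<nu>" "\<nu> < 1" and u: "continuous_on {0..T} u"
    and cd: "caputo_differentiable T \<nu> u" and bd: "\<And>t. t \<in> {0..T} \<Longrightarrow> \<bar>caputo T \<nu> u t\<bar> \<le> B"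
  shows "((\<lambda>t. (u t - u 0) / t powr \<nu>) \<longlongrightarrow> caputo T \<nu> u 0 / Gamma (1 + \<nu>)) (at_right 0)"
proof (rule tendstoI)
  fix e :: real assume e: "0 < e"
  define D where "D = caputo T \<nu> u"
  \<comment> \<open>Chosen so that the bound
    \<open>e' * t powr \<nu> / (\<nu> * Gamma \<nu>)\<close> on the remainder equals
    \<open>e / 2 * t powr \<nu>\<close>; the half makes the final inequality strict.\<close>
  define e' where "e' = e * (\<nu> * Gamma \<nu>) / 2"
  have G: "\<nu> * Gamma \<nu> > 0" using \<nu> by simp
  have e': "0 < e'" using e G by (simp add: e'_def)
  have "\<forall>\<^sub>F t in at_right 0. dist (D t) (D 0) < e'"
    unfolding D_def using caputo_tendsto_at_0[OF cd] e' by (rule tendstoD)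
  then obtain b where b: "0 < b" "\<And>t. 0 < t \<Longrightarrow> t < b \<Longrightarrow> dist (D t) (D 0) < e'"
    by (auto simp: eventually_at_right_field)
  show "\<forall>\<^sub>F t in at_right 0. dist ((u t - u 0) / t powr \<nu>) (caputo T \<nu> u 0 / Gamma (1 + \<nu>)) < e"
    using eventually_at_right_0_Ioo[OF min_less_iff_conj[THEN iffD2, OF conjI, OF b(1) T]]
  proof eventually_elim
    case (elim t)
    define I where "I = integral {0..t} (\<lambda>\<tau>. (t - \<tau>) powr (\<nu> - 1) * (D \<tau> - D 0))"
    have t: "t \<in> {0..T}" "0 < t" using elim by auto
    have "\<bar>I\<bar> \<le> e' * (t - 0) powr \<nu> / \<nu>"
      unfolding I_def
    proof (rule kernel_integral_bound)
      have "D absolutely_integrable_on {0..t}"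
        unfolding D_def by (rule absolutely_integrable_on_subinterval[OF caputo_inversion(1)[OF T \<nu> u cd bd]])
          (use t in auto)
      then show "(\<lambda>\<tau>. D \<tau> - D 0) absolutely_integrable_on {0..t}"
        by (intro set_integral_diff) auto
      \<comment> \<open>The choice of \<open>b\<close> covers positive arguments; at
        \<open>x = 0\<close> the difference is 0.\<close>
      show "\<bar>D x - D 0\<bar> \<le> e'" if "x \<in> {0..t}" for x
        using b(2)[of x] that elim e' by (cases "x = 0") (auto simp: dist_real_def less_imp_le)
    qed (use t \<nu> in auto)
    then have "\<bar>I\<bar> / Gamma \<nu> \<le> e' * t powr \<nu> / \<nu> / Gamma \<nu>"
      using \<nu> by (intro divide_right_mono) auto
    also have "\<dots> = e / 2 * t powr \<nu>"
      using \<nu> less_imp_neq[OF Gamma_real_pos[OF \<nu>(1)]] by (auto simp: e'_def field_simps)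
    also have "\<dots> < e * t powr \<nu>"
      using e t by simp
    finally have "\<bar>I / Gamma \<nu>\<bar> < e * t powr \<nu>"
      using \<nu> by (simp add: abs_divide)
    moreover have p: "0 < t powr \<nu>"
      using t by simp
    ultimately have "\<bar>I / Gamma \<nu> / t powr \<nu>\<bar> < e"
      by (simp only: abs_divide[of "I / Gamma \<nu>"] abs_of_pos pos_divide_less_eq)
    moreover have "u t - u 0 = D 0 / Gamma (1 + \<nu>) * t powr \<nu> + I / Gamma \<nu>"
      using caputo_representation(2)[OF T \<nu> u cd bd, of t] t(1) by (simp add: I_def D_def)
    then have "(u t - u 0) / t powr \<nu> = D 0 / Gamma (1 + \<nu>) + I / Gamma \<nu> / t powr \<nu>"
      using t by (simp add: add_divide_distrib)
    ultimately show ?case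
      by (simp only: dist_real_def D_def add_diff_cancel_left')
  qed
qed

text \<open>If \<open>\<phi>\<close> behaves like \<open>C * t powr \<nu>\<close>, then by l'Hopital
  its integral behaves like \<open>C * t powr (1 + \<nu>) / (1 + \<nu>)\<close>, and the quotient
  tends to \<open>1 + \<nu>\<close>. Dividing the two limits requires
  \<open>C \<noteq> 0\<close>.\<close>

lemma ratio_tendsto_of_power_asymptotics:
  fixes \<phi> :: "real \<Rightarrow> real"
  assumes T: "0 < T" and \<nu>: "0 < \<nu>" and \<phi>: "continuous_on {0..T} \<phi>"
    and lim: "((\<lambda>t. \<phi> t / t powr \<nu>) \<longlongrightarrow> C) (at_right 0)" and C: "C \<noteq> 0"
  shows "((\<lambda>t. t * \<phi> t / integral {0..t} \<phi> - 1) \<longlongrightarrow> \<nu>) (at_right 0)"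
proof -
  have der: "((\<lambda>t. integral {0..t} \<phi>) has_real_derivative \<phi> t) (at t within {0..T})" if "t \<in> {0..T}" for t
    by (rule integral_has_real_derivative[OF \<phi> that])
  have "continuous_on {0..T} (\<lambda>t. integral {0..t} \<phi>)"
    using der by (rule DERIV_continuous_on)
  then have "((\<lambda>t. integral {0..t} \<phi>) \<longlongrightarrow> integral {0..0} \<phi>) (at 0 within {0..T})"
    using T unfolding continuous_on_def by (auto dest!: bspec[where x=0])
  then have I0: "((\<lambda>t. integral {0..t} \<phi>) \<longlongrightarrow> 0) (at_right 0)"
    using T by (simp add: at_within_Icc_at_right)
  have *: "((\<lambda>t. integral {0..t} \<phi> / t powr (1 + \<nu>)) \<longlongrightarrow> C / (1 + \<nu>)) (at_right 0)"
  proof (rule lhopital_right[where f' = \<phi> and g' = "\<lambda>t. (1 + \<nu>) * t powr \<nu>"])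
    have "((\<lambda>t. t powr (1 + \<nu>)) \<longlongrightarrow> 0 powr (1 + \<nu>)) (at_right 0)"
      using \<nu> by (intro tendsto_powr' tendsto_intros) (auto simp: eventually_at_filter)
    then show "((\<lambda>t. t powr (1 + \<nu>)) \<longlongrightarrow> 0) (at_right 0)"
      using \<nu> by simp
    show "\<forall>\<^sub>F t in at_right 0. ((\<lambda>t. integral {0..t} \<phi>) has_real_derivative \<phi> t) (at t)"
      using eventually_at_right_0_Ioo[OF T]
    proof eventually_elim
      case (elim t)
      then show ?case using der[of t] by (simp add: at_within_Icc_at)
    qed
    show "\<forall>\<^sub>F t in at_right 0. ((\<lambda>t. t powr (1 + \<nu>)) has_real_derivative (1 + \<nu>) * t powr \<nu>) (at t)"
      using eventually_at_right_0_Ioo[OF T]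
    proof eventually_elim
      case (elim t)
      then show ?case by (auto intro!: derivative_eq_intros)
    qed
    have "((\<lambda>t. \<phi> t / t powr \<nu> / (1 + \<nu>)) \<longlongrightarrow> C / (1 + \<nu>)) (at_right 0)"
      using lim \<nu> by (intro tendsto_intros) auto
    then show "((\<lambda>t. \<phi> t / ((1 + \<nu>) * t powr \<nu>)) \<longlongrightarrow> C / (1 + \<nu>)) (at_right 0)"
      by (simp add: mult.commute)
  qed (use I0 \<nu> in \<open>auto simp: eventually_at_filter\<close>)
  have "((\<lambda>t. (\<phi> t / t powr \<nu>) / (integral {0..t} \<phi> / t powr (1 + \<nu>)) - 1) \<longlongrightarrow> C / (C / (1 + \<nu>)) - 1) (at_right 0)"
    using C \<nu> by (intro tendsto_diff tendsto_divide[OF lim *] tendsto_const) auto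
  moreover have "C / (C / (1 + \<nu>)) - 1 = \<nu>"
    using C by simp
  ultimately have **: "((\<lambda>t. (\<phi> t / t powr \<nu>) / (integral {0..t} \<phi> / t powr (1 + \<nu>)) - 1) \<longlongrightarrow> \<nu>) (at_right 0)"
    by (simp only:)
  show ?thesis
  proof (rule Lim_transform_eventually[OF **])
    show "\<forall>\<^sub>F t in at_right 0. (\<phi> t / t powr \<nu>) / (integral {0..t} \<phi> / t powr (1 + \<nu>)) - 1
        = t * \<phi> t / integral {0..t} \<phi> - 1"
      using eventually_at_right_0_Ioo[OF T]
    proof eventually_elim
      case (elim t)
      then have "t powr (1 + \<nu>) = t * t powr \<nu>" by (simp add: powr_add)
      then show ?case using elim by simp
    qed
  qed
qed

lemma caputo_order_recovery:
  assumes T: "0 < T" and \<nu>: "0 < \<nu>" "\<nu> < 1" and u: "continuous_on {0..T} u"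
    and cd: "caputo_differentiable T \<nu> u" and bd: "\<And>t. t \<in> {0..T} \<Longrightarrow> \<bar>caputo T \<nu> u t\<bar> \<le> B"
    and "caputo T \<nu> u 0 \<noteq> 0"
  shows "((\<lambda>t. t * (u t - u 0) / integral {0..t} (\<lambda>\<tau>. u \<tau> - u 0) - 1) \<longlongrightarrow> \<nu>) (at_right 0)"
proof (rule ratio_tendsto_of_power_asymptotics[OF T \<nu>(1)])
  show "continuous_on {0..T} (\<lambda>\<tau>. u \<tau> - u 0)"
    using u by (intro continuous_intros)
  show "((\<lambda>t. (u t - u 0) / t powr \<nu>) \<longlongrightarrow> caputo T \<nu> u 0 / Gamma (1 + \<nu>)) (at_right 0)"
    by (rule caputo_increment_asymptotics[OF T \<nu> u cd bd])
  show "caputo T \<nu> u 0 / Gamma (1 + \<nu>) \<noteq> 0"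
  proof -
    have "Gamma (1 + \<nu>) > 0"
      using \<nu> by simp
    then show ?thesis using assms(7) by simp
  qed
qed

section \<open>The Cauchy problem\<close>

theorem lemma3p1:
  fixes T Ts \<alpha> v0 :: real
    and M :: nat
    and \<nu> :: "nat \<Rightarrow> real"
    and r :: "nat \<Rightarrow> real \<Rightarrow> real"
    and K f0 v :: "real \<Rightarrow> real"
    and f :: "real \<Rightarrow> real \<Rightarrow> real"
    and ty :: operator_type
  assumes "0 < T" and "1 \<le> M"
    and "0 < \<nu> M" and "\<forall>i<M. \<nu> (Suc i) < \<nu> i" and "\<nu> 0 < 1"
    and "\<forall>i\<le>M. continuous_on {0..T} (r i)"
    and "\<forall>t\<in>{0..T}. r 0 t \<noteq> 0"
    and "K absolutely_integrable_on {0<..<T}"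
    and "continuous_on {0..T} f0"
    and "continuous_on ({0..T} \<times> UNIV) (\<lambda>(t, x). f t x)"
    and "0 < Ts" and "Ts \<le> T" and "0 < \<alpha>" and "\<alpha> < 1"
    and "classical_solution ty M \<nu> r K f0 f v0 Ts v"
    and "v \<in> solution_class M \<nu> \<alpha> Ts"
    and "\<forall>w\<in>solution_class M \<nu> \<alpha> Ts.
           classical_solution ty M \<nu> r K f0 f v0 Ts w \<longrightarrow> (\<forall>t\<in>{0..Ts}. w t = v t)"
    and "ty = Type_II \<Longrightarrow> \<forall>i\<le>M. coefficient_regularity (\<nu> i) \<alpha> Ts (r i)"
    and "ty = Type_I \<Longrightarrow> f0 0 + f 0 v0 - v0 \<noteq> 0"
    and "ty = Type_II \<Longrightarrow>
           f0 0 + f 0 v0 - v0 - v0 * (\<Sum>i=1..M. caputo Ts (\<nu> i) (r i) 0) \<noteq> 0"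
  shows
    "(ty = Type_I \<longrightarrow>
        ((\<lambda>t. t * (v t - v 0) / integral {0..t} (\<lambda>\<tau>. v \<tau> - v 0) - 1) \<longlongrightarrow> \<nu> 0) (at_right 0) \<and>
        (let D = caputo Ts (\<nu> 0) v;
             C0 = multi_caputo Type_I M \<nu> r Ts v 0 / (r 0 0 * Gamma (1 + \<nu> 0))
         in \<forall>t\<in>{0..Ts}.
              (\<lambda>\<tau>. (t - \<tau>) powr (\<nu> 0 - 1) * (D \<tau> - D 0)) absolutely_integrable_on {0..t} \<and>
              v t = v 0 + C0 * t powr \<nu> 0
                + 1 / Gamma (\<nu> 0) *
                  integral {0..t} (\<lambda>\<tau>. (t - \<tau>) powr (\<nu> 0 - 1) * (D \<tau> - D 0)))) \<and>
     (ty = Type_II \<longrightarrow>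
        ((\<lambda>t. t * (r 0 t * v t - r 0 0 * v 0)
               / integral {0..t} (\<lambda>\<tau>. r 0 \<tau> * v \<tau> - r 0 0 * v 0) - 1) \<longlongrightarrow> \<nu> 0) (at_right 0) \<and>
        (let D = caputo Ts (\<nu> 0) (\<lambda>s. r 0 s * v s);
             C1 = (multi_caputo Type_II M \<nu> r Ts v 0
                    - v 0 * (\<Sum>i=1..M. caputo Ts (\<nu> i) (r i) 0)) / Gamma (1 + \<nu> 0)
         in \<forall>t\<in>{0..Ts}.
              (\<lambda>\<tau>. (t - \<tau>) powr (\<nu> 0 - 1) * (D \<tau> - D 0)) absolutely_integrable_on {0..t} \<and>
              r 0 t * v t = r 0 0 * v 0 + C1 * t powr \<nu> 0
                + 1 / Gamma (\<nu> 0) *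
                  integral {0..t} (\<lambda>\<tau>. (t - \<tau>) powr (\<nu> 0 - 1) * (D \<tau> - D 0))))"
proof -
  have \<nu>_less: "\<nu> j < \<nu> i" if "i < j" "j \<le> M" for i j
    using that
  proof (induction j)
    case (Suc j)
    then show ?case using assms(4) by (cases "i = j") (auto dest!: spec[where x=j])
  qed simp
  have \<nu>: "0 < \<nu> i" "\<nu> i < 1" if "i \<le> M" for i
  proof -
    show "0 < \<nu> i"
      using \<nu>_less[of i M] that assms(3) by (cases "i = M") auto
    show "\<nu> i < 1"
      using \<nu>_less[of 0 i] that assms(5) by (cases "i = 0") auto
  qed
  have \<nu>0: "0 < \<nu> 0" "\<nu> 0 < 1"
    using \<nu> by auto
  have v: "continuous_on {0..Ts} v" "caputo_differentiable Ts (\<nu> 0) v"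
    "continuous_on {0..Ts} (caputo Ts (\<nu> 0) v)"
    and vi: "\<And>i. i \<in> {1..M} \<Longrightarrow> caputo_differentiable Ts (\<nu> i) v"
    using assms(16) by (auto simp: solution_class_def caputo_holder_space_def)
  \<comment> \<open>Inversion makes \<open>v\<close> Hoelder with exponent \<open>\<nu> 0\<close>,
    which is above all the lower orders \<open>\<nu> i\<close>.\<close>
  obtain L where L: "\<And>s t. s \<in> {0..Ts} \<Longrightarrow> t \<in> {0..Ts} \<Longrightarrow> \<bar>v t - v s\<bar> \<le> L * \<bar>t - s\<bar> powr \<nu> 0"
    using caputo_continuous_imp_holder[OF assms(11) \<nu>0 v] by blast
  have vb: "\<bar>v t - v 0\<bar> \<le> L * t powr \<nu> 0" if "t \<in> {0..Ts}" for t
    using L[of 0 t] that by simp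
  have atMost: "{..M} = insert 0 {1..M}"
    by auto
  \<comment> \<open>At time 0 the convolution is an integral over a single point and vanishes, so
    the equation expresses the operator there by the data.\<close>
  have v0: "v 0 = v0"
    and def: "multi_caputo_defined ty M \<nu> r Ts v"
    and eq0: "multi_caputo ty M \<nu> r Ts v 0 = f0 0 + f 0 v0 - v0"
    using assms(11,15) unfolding classical_solution_def
    by (auto dest!: bspec[where x=0] simp: time_convolution_def)
  show ?thesis
  proof (cases ty)
    case Type_I
    obtain B where B: "\<And>t. t \<in> {0..Ts} \<Longrightarrow> \<bar>caputo Ts (\<nu> 0) v t\<bar> \<le> B"
      using continuous_on_Icc_bounded[OF v(3)] by blast
    \<comment> \<open>The orders with \<open>i \<ge> 1\<close> lie below the exponent
      \<open>\<nu> 0\<close>, so only the leading term survives at 0.\<close>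
    have "caputo Ts (\<nu> i) v 0 = 0" if "i \<in> {1..M}" for i
      by (rule caputo_at_0_eq_0[OF assms(11) _ _ _ v(1) vi[OF that] vb]) (use that \<nu> \<nu>_less in auto)
    then have mc: "multi_caputo Type_I M \<nu> r Ts v 0 = r 0 0 * caputo Ts (\<nu> 0) v 0"
      by (simp add: atMost)
    have r00: "r 0 0 \<noteq> 0"
      using assms(1,7) by simp
    have nz: "caputo Ts (\<nu> 0) v 0 \<noteq> 0"
      using mc eq0 assms(19) Type_I by auto
    have rep: "\<forall>t\<in>{0..Ts}.
        (\<lambda>\<tau>. (t - \<tau>) powr (\<nu> 0 - 1) * (caputo Ts (\<nu> 0) v \<tau> - caputo Ts (\<nu> 0) v 0)) absolutely_integrable_on {0..t} \<and>
        v t = v 0 + caputo Ts (\<nu> 0) v 0 / Gamma (1 + \<nu> 0) * t powr \<nu> 0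
          + 1 / Gamma (\<nu> 0) * integral {0..t} (\<lambda>\<tau>. (t - \<tau>) powr (\<nu> 0 - 1) * (caputo Ts (\<nu> 0) v \<tau> - caputo Ts (\<nu> 0) v 0))"
    proof (intro ballI conjI)
      fix t assume t: "t \<in> {0..Ts}"
      note rep = caputo_representation[where T = Ts and \<nu> = "\<nu> 0" and u = v and t = t and B = B,
          OF assms(11) \<nu>0 v(1,2) _ t]
      show "(\<lambda>\<tau>. (t - \<tau>) powr (\<nu> 0 - 1) * (caputo Ts (\<nu> 0) v \<tau> - caputo Ts (\<nu> 0) v 0))
          absolutely_integrable_on {0..t}"
        by (rule rep(1)) (rule B)
      show "v t = v 0 + caputo Ts (\<nu> 0) v 0 / Gamma (1 + \<nu> 0) * t powr \<nu> 0
          + 1 / Gamma (\<nu> 0) * integral {0..t}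
              (\<lambda>\<tau>. (t - \<tau>) powr (\<nu> 0 - 1) * (caputo Ts (\<nu> 0) v \<tau> - caputo Ts (\<nu> 0) v 0))"
        by (rule rep(2)) (rule B)
    qed
    have lim: "((\<lambda>t. t * (v t - v 0) / integral {0..t} (\<lambda>\<tau>. v \<tau> - v 0) - 1)
        \<longlongrightarrow> \<nu> 0) (at_right 0)"
      by (rule caputo_order_recovery[OF assms(11) \<nu>0 v(1,2) B nz])
    have "multi_caputo Type_I M \<nu> r Ts v 0 / (r 0 0 * Gamma (1 + \<nu> 0))
        = caputo Ts (\<nu> 0) v 0 / Gamma (1 + \<nu> 0)"
      using mc r00 by simp
    then show ?thesis
      using lim rep by (simp only: Type_I operator_type.distinct Let_def simp_thms)
  next
    case Type_II
    have reg: "coefficient_regularity (\<nu> i) \<alpha> Ts (r i)" if "i \<le> M" for i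
      using assms(18) Type_II that by simp
    have ri: "continuous_on {0..Ts} (r i)" "caputo_differentiable Ts (\<nu> i) (r i)" if "i \<le> M" for i
      by (rule coefficient_regularityD[OF assms(11) \<nu>[OF that] assms(13) reg[OF that]]; assumption)+
    have rv: "caputo_differentiable Ts (\<nu> i) (\<lambda>s. r i s * v s)" if "i \<le> M" for i
      using def Type_II that by simp
    let ?u = "\<lambda>s. r 0 s * v s"
    have u: "continuous_on {0..Ts} ?u"
      using ri(1)[of 0] v by (intro continuous_intros) auto
    \<comment> \<open>For \<open>r 0 * v\<close> the classical solution provides differentiability
      for positive times and the limit at 0; boundedness comes from the product estimate.\<close>
    obtain B where B: "\<And>t. t \<in> {0..Ts} \<Longrightarrow> \<bar>caputo Ts (\<nu> 0) ?u t\<bar> \<le> B"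
    proof -
      obtain L' \<mu> where "continuous_on {0..Ts} (r 0)" "caputo_differentiable Ts (\<nu> 0) (r 0)"
        "continuous_on {0..Ts} (caputo Ts (\<nu> 0) (r 0))" "\<nu> 0 < \<mu>"
        "\<And>s t. s \<in> {0..Ts} \<Longrightarrow> t \<in> {0..Ts} \<Longrightarrow> \<bar>r 0 t - r 0 s\<bar> \<le> L' * \<bar>t - s\<bar> powr \<mu>"
        by (rule coefficient_regularityD[OF assms(11) \<nu>0 assms(13) reg[of 0, simplified]])
          (rule that; assumption)
      then have "\<exists>B. \<forall>t\<in>{0..Ts}. \<bar>caputo Ts (\<nu> 0) ?u t\<bar> \<le> B"
        using assms(11) \<nu>0 v rv[of 0, simplified] by (intro caputo_product_bounded)
      then show thesis
        using that by blast
    qed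
    have "caputo Ts (\<nu> i) (\<lambda>s. r i s * v s) 0 = v 0 * caputo Ts (\<nu> i) (r i) 0" if "i \<in> {1..M}" for i
      by (rule caputo_product_at_0[OF assms(11) _ _ _ ri v(1) rv vb]) (use that \<nu> \<nu>_less in auto)
    \<comment> \<open>The subtracted sum is exactly the contribution of the lower orders at 0, which
      leaves the term of order \<open>\<nu> 0\<close>.\<close>
    then have mc: "multi_caputo Type_II M \<nu> r Ts v 0 - v 0 * (\<Sum>i=1..M. caputo Ts (\<nu> i) (r i) 0)
        = caputo Ts (\<nu> 0) ?u 0"
      by (simp add: atMost sum_distrib_left)
    have nz: "caputo Ts (\<nu> 0) ?u 0 \<noteq> 0"
      using mc eq0 assms(20) Type_II v0 by auto
    have rep: "\<forall>t\<in>{0..Ts}.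
        (\<lambda>\<tau>. (t - \<tau>) powr (\<nu> 0 - 1) * (caputo Ts (\<nu> 0) ?u \<tau> - caputo Ts (\<nu> 0) ?u 0)) absolutely_integrable_on {0..t} \<and>
        r 0 t * v t = r 0 0 * v 0 + caputo Ts (\<nu> 0) ?u 0 / Gamma (1 + \<nu> 0) * t powr \<nu> 0
          + 1 / Gamma (\<nu> 0) * integral {0..t} (\<lambda>\<tau>. (t - \<tau>) powr (\<nu> 0 - 1) * (caputo Ts (\<nu> 0) ?u \<tau> - caputo Ts (\<nu> 0) ?u 0))"
    proof (intro ballI conjI)
      fix t assume t: "t \<in> {0..Ts}"
      note rep = caputo_representation[where T = Ts and \<nu> = "\<nu> 0" and u = ?u and t = t and B = B,
          OF assms(11) \<nu>0 u rv[of 0, simplified] _ t]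
      show "(\<lambda>\<tau>. (t - \<tau>) powr (\<nu> 0 - 1) * (caputo Ts (\<nu> 0) ?u \<tau> - caputo Ts (\<nu> 0) ?u 0))
          absolutely_integrable_on {0..t}"
        by (rule rep(1)) (rule B)
      show "r 0 t * v t = r 0 0 * v 0 + caputo Ts (\<nu> 0) ?u 0 / Gamma (1 + \<nu> 0) * t powr \<nu> 0
          + 1 / Gamma (\<nu> 0) * integral {0..t}
              (\<lambda>\<tau>. (t - \<tau>) powr (\<nu> 0 - 1) * (caputo Ts (\<nu> 0) ?u \<tau> - caputo Ts (\<nu> 0) ?u 0))"
        by (rule rep(2)) (rule B)
    qed
    have lim: "((\<lambda>t. t * (r 0 t * v t - r 0 0 * v 0) / integral {0..t} (\<lambda>\<tau>. r 0 \<tau> * v \<tau> - r 0 0 * v 0) - 1)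
        \<longlongrightarrow> \<nu> 0) (at_right 0)"
      by (rule caputo_order_recovery[OF assms(11) \<nu>0 u rv[of 0, simplified] B nz])
    show ?thesis
      using lim rep by (simp only: Type_II operator_type.distinct Let_def simp_thms mc)
  qed
qed

end
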